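(* Let $n\ge 3$, let $p\in(1,n)$, let $\Omega\subset\mathbb{R}^n$ be a bounded convex domain (i.e. a nonempty bounded open convex set), and let $u$ be the $p$-capacitary potential function of $\Omega$, i.e. the (classical) solution of $$\operatorname{div}(|\nabla u|^{p-2}\nabla u)=0\ \text{ in }\mathbb{R}^n\setminus\overline{\Omega},\qquad u=1\ \text{ in }\overline{\Omega},\qquad \lim_{|x|\to+\infty}u(x)=0 .$$ Set $q=\frac{n-p}{p-1}$. If $u$ is $(-1/q)$-concave, that is, if the function $u^{-1/q}=u^{(1-p)/(n-p)}$ is convex in $\mathbb{R}^n$, then $\Omega$ is a ball.
   Context: For $\alpha<0$, a positive function $v$ on $\mathbb{R}^n$ is called $\alpha$-concave if $v^{\alpha}$ is convex. The solution $u$ is understood as the classical solution, $u\in C(\mathbb{R}^n)\cap C^2(\mathbb{R}^n\setminus\overline{\Omega})$; it is defined on all of $\mathbb{R}^n$ and equals $1$ on $\overline{\Omega}$. A ball is a Euclidean ball $B(x_0,R)$ with $x_0\in\mathbb{R}^n$ and $R>0$. *)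

theory Defs
  imports "HOL-Analysis.Analysis"
begin

definition gradient :: "('a::euclidean_space \<Rightarrow> real) \<Rightarrow> 'a \<Rightarrow> 'a" where
  "gradient f x = (THE D. GDERIV f x :> D)"

definition divergence :: "('a::euclidean_space \<Rightarrow> 'a) \<Rightarrow> 'a \<Rightarrow> real" where
  "divergence V x = (\<Sum>b\<in>Basis. frechet_derivative V (at x) b \<bullet> b)"

text \<open>Intended for open sets \<open>S\<close>: \<open>g\<close> is the gradient of \<open>f\<close> on \<open>S\<close>, and \<open>H\<close> is the Hessian,
  required to be continuous in the operator norm.\<close>

definition C2_on :: "'a::euclidean_space set \<Rightarrow> ('a \<Rightarrow> real) \<Rightarrow> bool" where
  "C2_on S f \<longleftrightarrow> (\<exists>(g :: 'a \<Rightarrow> 'a) (H :: 'a \<Rightarrow> 'a \<Rightarrow>\<^sub>L 'a).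
     (\<forall>x\<in>S. (GDERIV f x :> g x) \<and> (g has_derivative blinfun_apply (H x)) (at x)) \<and>
     continuous_on S H)"

text \<open>The field \<open>|\<nabla>u|\<^sup>p\<^sup>-\<^sup>2 \<nabla>u\<close>. At a critical point of \<open>u\<close> it takes the value \<open>0\<close>, which is its
  continuous extension for \<open>p > 1\<close>; for \<open>p = 2\<close> it is \<open>\<nabla>u\<close> everywhere, although
  \<open>0 powr 0 = 0\<close>.\<close>

definition p_flux :: "real \<Rightarrow> ('a::euclidean_space \<Rightarrow> real) \<Rightarrow> 'a \<Rightarrow> 'a" where
  "p_flux p u x = norm (gradient u x) powr (p - 2) *\<^sub>R gradient u x"

text \<open>Classical sense: the flux is differentiable and its divergence vanishes at every point of \<open>S\<close>.
  The differentiability clause is needed because the divergence is a total function here.\<close>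

definition p_harmonic_on :: "real \<Rightarrow> 'a::euclidean_space set \<Rightarrow> ('a \<Rightarrow> real) \<Rightarrow> bool" where
  "p_harmonic_on p S u \<longleftrightarrow>
     C2_on S u \<and> (\<forall>x\<in>S. p_flux p u differentiable (at x) \<and> divergence (p_flux p u) x = 0)"

definition p_capacitary_potential ::
  "real \<Rightarrow> 'a::euclidean_space set \<Rightarrow> ('a \<Rightarrow> real) \<Rightarrow> bool" where
  "p_capacitary_potential p \<Omega> u \<longleftrightarrow>
     continuous_on UNIV u \<and>
     p_harmonic_on p (- closure \<Omega>) u \<and>
     (\<forall>x\<in>closure \<Omega>. u x = 1) \<and>
     (u \<longlongrightarrow> 0) at_infinity"

text \<open>Concavity of negative order: used only with \<open>\<alpha> < 0\<close>.\<close>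

definition alpha_concave :: "real \<Rightarrow> ('a::euclidean_space \<Rightarrow> real) \<Rightarrow> bool" where
  "alpha_concave \<alpha> v \<longleftrightarrow> (\<forall>x. v x > 0) \<and> convex_on UNIV (\<lambda>x. v x powr \<alpha>)"

end

theory Submission
  imports Defs
begin

text \<open>Let \<open>v = u\<^sup>-\<^sup>1\<^sup>/\<^sup>q\<close>, write \<open>g\<close> and \<open>H\<close> for its gradient and Hessian outside the closure of \<open>\<Omega>\<close>, and let \<open>n\<close> be the
  dimension. There \<open>v\<close> satisfies
  \<open>v (|g|\<^sup>2 tr H + (p - 2) H g \<bullet> g) = (n - 1) |g|\<^sup>4\<close>, whose model solutions are the cones \<open>c |x - x\<^sub>0|\<close>; they
  belong to balls, and \<open>|g|\<close> is constant on them. The proof shows that \<open>|g|\<close> is constant for the given \<open>v\<close>, and that this forces a cone.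

  Two opposite facts make \<open>|g|\<close> constant. Since \<open>v\<close> is convex, \<open>|g|\<close> does not decrease from \<open>x\<close> to \<open>x + t g x\<close>,
  so its supremum is approached at infinity (\<open>norm_grad_forward\<close>). On the other hand \<open>|g|\<close> satisfies a maximum principle in
  which infinity does not count as boundary: outside a large ball it is bounded by its maximum
  on the sphere (\<open>max_principle_without_infinity\<close>, with the comparison functions \<open>M + \<epsilon> v\<^sup>\<beta>\<close> for \<open>0 < \<beta> < q\<close>). Hence \<open>|g|\<close> attains
  its supremum, and the strong maximum principle with Hopf's barrier gives constancy
  (\<open>norm_grad_constant\<close>).

  The differential inequality for \<open>|g|\<close> behind both maximum principles formally involves third derivatives of \<open>v\<close>, and \<open>v\<close> is only
  \<open>C\<^sup>2\<close>. It is therefore proved in the viscosity sense (\<open>length_superjet\<close>): dilates of \<open>v\<close> solve the same equation, their difference quotients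
  are \<open>C\<^sup>2\<close>, and in the limit they give the inequality for any quadratic polynomial that
  touches \<open>|g|\<close> from above (\<open>linearized_nonneg\<close>).

  When \<open>|g| = c\<close>, the gradient takes the same value at \<open>x\<close> and at \<open>x + t g x\<close>. Differentiating this relation yields \<open>tr H\<^sup>2\<close>,
  the equation yields \<open>tr H\<close>, and the two together determine \<open>H\<close> (\<open>hess_eq\<close>); integrating, \<open>v = c |x - x\<^sub>0|\<close>
  (\<open>solution_is_cone\<close>). As \<open>v = 1\<close> on the frontier of \<open>\<Omega>\<close>, the frontier lies on a sphere.\<close>

section \<open>Traces and second-order calculus\<close>

definition tr :: "('a::euclidean_space \<Rightarrow> 'a) \<Rightarrow> real" where
  "tr A = (\<Sum>b\<in>Basis. A b \<bullet> b)"

text \<open>For the gradient \<open>g\<close> and the Hessian \<open>K\<close> of a function this is \<open>|g|\<^sup>4\<^sup>-\<^sup>p\<close> times its \<open>p\<close>-Laplacian. Being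
  polynomial in \<open>g\<close> and \<open>K\<close>, it needs no separate treatment of critical points.\<close>
definition p_trace :: "real \<Rightarrow> 'a::euclidean_space \<Rightarrow> ('a \<Rightarrow> 'a) \<Rightarrow> real" where
  "p_trace p g K = (g \<bullet> g) * tr K + (p - 2) * (K g \<bullet> g)"

lemma tr_add: "tr (\<lambda>x. A x + B x) = tr A + tr B"
  by (simp add: tr_def inner_add_left sum.distrib)

lemma tr_diff: "tr (\<lambda>x. A x - B x) = tr A - tr B"
  by (simp add: tr_def inner_diff_left sum_subtractf)

lemma tr_scaleR: "tr (\<lambda>x. c *\<^sub>R A x) = c * tr A"
  by (simp add: tr_def sum_distrib_left)

lemma tr_id: "tr (\<lambda>x::'a::euclidean_space. x) = DIM('a)"
  by (simp add: tr_def)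

lemma tr_rank_one: "tr (\<lambda>x. (x \<bullet> a) *\<^sub>R b) = a \<bullet> b"
  unfolding tr_def by (subst euclidean_inner) (simp add: inner_commute)

lemma tr_rank_one_scaled: "tr (\<lambda>x. (c * (x \<bullet> a)) *\<^sub>R b) = c * (a \<bullet> b)"
  using tr_scaleR[of c "\<lambda>x. (x \<bullet> a) *\<^sub>R b"] by (simp add: tr_rank_one)

lemmas tr_simps = tr_add tr_diff tr_scaleR tr_id tr_rank_one tr_rank_one_scaled

lemma linear_eq_sum_Basis:
  fixes K :: "'a::euclidean_space \<Rightarrow> 'b::real_vector"
  assumes "linear K"
  shows "K e = (\<Sum>b\<in>Basis. (e \<bullet> b) *\<^sub>R K b)"
proof -
  have "K e = K (\<Sum>b\<in>Basis. (e \<bullet> b) *\<^sub>R b)"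
    by (simp add: euclidean_representation)
  also have "\<dots> = (\<Sum>b\<in>Basis. (e \<bullet> b) *\<^sub>R K b)"
    using assms by (simp add: linear_sum linear_scale)
  finally show ?thesis .
qed

text \<open>Summing the form over the projections \<open>b - (e \<bullet> b) e\<close> of the basis vectors gives the trace
  of \<open>K\<close> on the orthogonal complement of \<open>e\<close>.\<close>

lemma psd_le_tr:
  fixes K :: "'a::euclidean_space \<Rightarrow> 'a"
  assumes "linear K" and psd: "\<And>w. 0 \<le> K w \<bullet> w" and "norm e = 1"
  shows "K e \<bullet> e \<le> tr K"
proof -
  have "K e \<bullet> e = (\<Sum>b\<in>Basis. (e \<bullet> b) * (K b \<bullet> e))"
    by (subst linear_eq_sum_Basis[OF assms(1)]) (simp add: inner_sum_left)
  moreover have "K e \<bullet> e = (\<Sum>b\<in>Basis. (e \<bullet> b) * (K e \<bullet> b))"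
    by (subst euclidean_inner) (simp add: mult.commute)
  moreover have "(\<Sum>b\<in>Basis. (e \<bullet> b)\<^sup>2 * (K e \<bullet> e)) = K e \<bullet> e"
  proof -
    have "(\<Sum>b\<in>Basis. (e \<bullet> b)\<^sup>2) = e \<bullet> e"
      by (simp add: euclidean_inner[of e e] power2_eq_square)
    then show ?thesis
      using assms(3) by (simp add: sum_distrib_right[symmetric] dot_square_norm)
  qed
  moreover have "K (b - (e \<bullet> b) *\<^sub>R e) \<bullet> (b - (e \<bullet> b) *\<^sub>R e)
      = K b \<bullet> b - (e \<bullet> b) * (K b \<bullet> e) - (e \<bullet> b) * (K e \<bullet> b) + (e \<bullet> b)\<^sup>2 * (K e \<bullet> e)" for b
    using assms(1) by (simp add: linear_diff linear_scale inner_diff_left inner_diff_right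
        power2_eq_square algebra_simps)
  then have "0 \<le> (\<Sum>b\<in>Basis. K b \<bullet> b - (e \<bullet> b) * (K b \<bullet> e) - (e \<bullet> b) * (K e \<bullet> b)
      + (e \<bullet> b)\<^sup>2 * (K e \<bullet> e))"
    using psd by (metis (no_types, lifting) sum_nonneg)
  ultimately show ?thesis
    by (simp add: tr_def sum.distrib sum_subtractf)
qed

text \<open>Ellipticity: up to the factor \<open>|g|\<^sup>2\<close>, the direction of \<open>g\<close> has weight \<open>p - 1 > 0\<close> and the orthogonal directions
  have weight \<open>1\<close>.\<close>
lemma p_trace_nonneg:
  fixes K :: "'a::euclidean_space \<Rightarrow> 'a"
  assumes "linear K" and psd: "\<And>w. 0 \<le> K w \<bullet> w" and "1 < p"
  shows "0 \<le> p_trace p g K"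
proof (cases "g = 0")
  case False
  have "K (sgn g) \<bullet> sgn g \<le> tr K"
    by (intro psd_le_tr assms) (simp add: norm_sgn False)
  then have "K g \<bullet> g \<le> (g \<bullet> g) * tr K"
    using False assms(1)
    by (simp add: sgn_div_norm linear_scale divide_simps power2_norm_eq_inner[symmetric]
        power2_eq_square mult.commute split: if_splits)
  moreover have "0 \<le> (p - 1) * (K g \<bullet> g)"
    using psd assms(3) by simp
  ultimately show ?thesis
    by (simp add: p_trace_def algebra_simps)
qed (simp add: p_trace_def)

lemma p_trace_mono:
  fixes K L :: "'a::euclidean_space \<Rightarrow> 'a"
  assumes "linear K" "linear L" and "\<And>w. K w \<bullet> w \<le> L w \<bullet> w" and "1 < p"
  shows "p_trace p g K \<le> p_trace p g L"
  using p_trace_nonneg[of "\<lambda>w. L w - K w" p g] assms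
  by (auto simp: p_trace_def tr_diff linear_compose_sub inner_diff_left algebra_simps)

lemma p_trace_rank_one_id:
  fixes g y :: "'a::euclidean_space"
  shows "p_trace p g (\<lambda>w. \<alpha> *\<^sub>R (w \<bullet> y) *\<^sub>R y + \<beta> *\<^sub>R w)
    = \<alpha> * ((g \<bullet> g) * (y \<bullet> y) + (p - 2) * (g \<bullet> y)\<^sup>2) + \<beta> * (real DIM('a) + p - 2) * (g \<bullet> g)"
  by (simp add: p_trace_def tr_simps inner_add_left inner_commute power2_eq_square algebra_simps)

text \<open>The remainder along a segment has derivative \<open>(g(x + sw) - g x - s A w) \<bullet> w\<close>, which
  differentiability of the gradient at \<open>x\<close> makes small.\<close>
lemma taylor_peano:
  fixes f :: "'a::euclidean_space \<Rightarrow> real"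
  assumes "open S" "x \<in> S" and grad: "\<And>y. y \<in> S \<Longrightarrow> GDERIV f y :> g y"
    and hess: "(g has_derivative A) (at x)" and "0 < \<delta>"
  shows "\<forall>\<^sub>F y in nhds x. \<bar>f y - (f x + g x \<bullet> (y - x) + A (y - x) \<bullet> (y - x) / 2)\<bar> \<le> \<delta> * (norm (y - x))\<^sup>2"
proof -
  obtain r0 where r0: "0 < r0" "ball x r0 \<subseteq> S"
    using assms(1,2) openE by blast
  obtain r1 where r1: "0 < r1" "\<And>y. norm (y - x) < r1 \<Longrightarrow> norm (g y - g x - A (y - x)) \<le> \<delta> * norm (y - x)"
    using hess \<open>0 < \<delta>\<close> unfolding has_derivative_at_alt by blast
  have linA: "linear A" using hess has_derivative_linear by blast
  show ?thesis
  proof (rule eventually_nhds_metric[THEN iffD2], intro exI[of _ "min r0 r1"] conjI allI impI)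
    fix y assume y: "dist y x < min r0 r1"
    define w where "w = y - x"
    let ?r = "\<lambda>s. f (x + s *\<^sub>R w) - s * (g x \<bullet> w) - s\<^sup>2 / 2 * (A w \<bullet> w)"
    have small: "norm (s *\<^sub>R w) < min r0 r1" if "0 \<le> s" "s \<le> 1" for s
      using that y mult_left_le_one_le[of "norm w" s] by (auto simp: w_def dist_norm)
    have D: "(?r has_real_derivative (g (x + s *\<^sub>R w) - g x - A (s *\<^sub>R w)) \<bullet> w) (at s)"
      if "0 \<le> s" "s \<le> 1" for s
    proof -
      have "x + s *\<^sub>R w \<in> S"
        using small[OF that] r0(2) by (auto simp: subset_iff dist_norm)
      then have "(f has_derivative (\<lambda>h. h \<bullet> g (x + s *\<^sub>R w))) (at (x + s *\<^sub>R w))"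
        using grad by (simp add: gderiv_def)
      moreover have "((\<lambda>s. x + s *\<^sub>R w) has_derivative (\<lambda>h. h *\<^sub>R w)) (at s)"
        by (auto intro!: derivative_eq_intros)
      ultimately have "((\<lambda>s. f (x + s *\<^sub>R w)) has_derivative (\<lambda>h. (h *\<^sub>R w) \<bullet> g (x + s *\<^sub>R w))) (at s)"
        by (rule has_derivative_compose[rotated])
      then have "((\<lambda>s. f (x + s *\<^sub>R w)) has_real_derivative w \<bullet> g (x + s *\<^sub>R w)) (at s)"
        by (simp add: has_field_derivative_def mult_commute_abs)
      then show ?thesis
        by (auto intro!: derivative_eq_intros
            simp: inner_diff_left linear_scale[OF linA] inner_commute algebra_simps)
    qed
    have "\<exists>s>0. s < 1 \<and> ?r 1 - ?r 0 = (1 - 0) * ((g (x + s *\<^sub>R w) - g x - A (s *\<^sub>R w)) \<bullet> w)"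
      by (rule MVT2) (use D in auto)
    then obtain s where s: "0 < s" "s < 1" "?r 1 - ?r 0 = (g (x + s *\<^sub>R w) - g x - A (s *\<^sub>R w)) \<bullet> w"
      by auto
    have "\<bar>?r 1 - ?r 0\<bar> \<le> norm (g (x + s *\<^sub>R w) - g x - A (s *\<^sub>R w)) * norm w"
      unfolding s(3) by (rule Cauchy_Schwarz_ineq2)
    also have "\<dots> \<le> \<delta> * norm (s *\<^sub>R w) * norm w"
      using r1(2)[of "x + s *\<^sub>R w"] small[of s] s by (intro mult_right_mono) auto
    also have "\<dots> \<le> \<delta> * (norm w)\<^sup>2"
      using s \<open>0 < \<delta>\<close> by (auto simp: power2_eq_square intro!: mult_right_mono mult_left_le_one_le)
    finally show "\<bar>f y - (f x + g x \<bullet> (y - x) + A (y - x) \<bullet> (y - x) / 2)\<bar> \<le> \<delta> * (norm (y - x))\<^sup>2"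
      by (simp add: diff_diff_eq flip: w_def) (simp add: w_def)
  qed (use r0 r1 in auto)
qed

lemma eventually_nhds_along_line:
  fixes x w :: "'a::real_normed_vector"
  assumes "\<forall>\<^sub>F y in nhds x. Q y"
  shows "\<forall>\<^sub>F s in at_right 0. Q (x + s *\<^sub>R w)"
proof -
  have "((\<lambda>s. x + s *\<^sub>R w) \<longlongrightarrow> x + 0 *\<^sub>R w) (at_right (0::real))"
    by (intro tendsto_intros)
  then show ?thesis
    using assms by (simp add: filterlim_iff)
qed

lemma local_max_second_order:
  fixes f :: "'a::euclidean_space \<Rightarrow> real"
  assumes "open S" "x \<in> S" and grad: "\<And>y. y \<in> S \<Longrightarrow> GDERIV f y :> g y"
    and hess: "(g has_derivative A) (at x)" and max: "\<forall>\<^sub>F y in nhds x. f y \<le> f x"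
  shows "g x = 0" and "A w \<bullet> w \<le> 0"
proof -
  have "(\<lambda>h. h \<bullet> g x) = (\<lambda>v. 0)"
  proof (rule has_derivative_local_max)
    show "(f has_derivative (\<lambda>h. h \<bullet> g x)) (at x)"
      using grad[OF \<open>x \<in> S\<close>] by (simp add: gderiv_def)
    show "\<forall>\<^sub>F y in at x. f y \<le> f x"
      using max by (simp add: eventually_at_filter eventually_mono)
  qed
  then show g0: "g x = 0" by (metis inner_eq_zero_iff)
  have linA: "linear A" using hess has_derivative_linear by blast
  have key: "A w \<bullet> w \<le> \<delta> * (2 * (norm w)\<^sup>2)" if "0 < \<delta>" for \<delta>
  proof -
    have "\<forall>\<^sub>F y in nhds x. A (y - x) \<bullet> (y - x) / 2 \<le> \<delta> * (norm (y - x))\<^sup>2"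
    proof -
      have "\<forall>\<^sub>F y in nhds x. \<bar>f y - (f x + g x \<bullet> (y - x) + A (y - x) \<bullet> (y - x) / 2)\<bar>
          \<le> \<delta> * (norm (y - x))\<^sup>2"
        by (rule taylor_peano[OF assms(1,2)]) (use grad hess that in auto)
      then show ?thesis
        using max by eventually_elim (simp add: g0)
    qed
    from eventually_nhds_along_line[OF this, of w]
    have "\<forall>\<^sub>F s in at_right (0::real). s\<^sup>2 * (A w \<bullet> w) \<le> s\<^sup>2 * (\<delta> * (2 * (norm w)\<^sup>2))"
      by eventually_elim
        (simp add: linear_scale[OF linA] power_mult_distrib, simp add: power2_eq_square algebra_simps)
    moreover have "\<forall>\<^sub>F s in at_right (0::real). 0 < s"
      by (simp add: eventually_at_filter)
    ultimately have "\<forall>\<^sub>F s in at_right (0::real). A w \<bullet> w \<le> \<delta> * (2 * (norm w)\<^sup>2)"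
      by eventually_elim (simp add: mult_le_cancel_left)
    then show ?thesis by (simp add: eventually_const trivial_limit_at_right_real)
  qed
  show "A w \<bullet> w \<le> 0"
  proof (rule tendsto_lowerbound)
    show "((\<lambda>\<delta>. \<delta> * (2 * (norm w)\<^sup>2)) \<longlongrightarrow> 0) (at_right 0)"
      by (auto intro!: tendsto_eq_intros)
    show "\<forall>\<^sub>F \<delta> in at_right 0. A w \<bullet> w \<le> \<delta> * (2 * (norm w)\<^sup>2)"
      using key by (simp add: eventually_at_filter)
  qed simp
qed

text \<open>The predicate \<open>C2_on\<close> hides the gradient and the Hessian behind an existential quantifier; here they
  have names.\<close>
locale C2_function =
  fixes S :: "'a::euclidean_space set" and f :: "'a \<Rightarrow> real" and g :: "'a \<Rightarrow> 'a"
    and H :: "'a \<Rightarrow> 'a \<Rightarrow>\<^sub>L 'a"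
  assumes open_dom: "open S"
    and grad: "x \<in> S \<Longrightarrow> GDERIV f x :> g x"
    and hess: "x \<in> S \<Longrightarrow> (g has_derivative blinfun_apply (H x)) (at x)"
    and hess_cont: "continuous_on S H"
begin

lemma has_derivative_grad: "x \<in> S \<Longrightarrow> (f has_derivative (\<lambda>h. h \<bullet> g x)) (at x)"
  using grad by (simp add: gderiv_def)

lemma isCont_grad: "x \<in> S \<Longrightarrow> isCont g x"
  using hess has_derivative_continuous by blast

lemma isCont_hess: "x \<in> S \<Longrightarrow> isCont H x"
  using hess_cont open_dom continuous_on_eq_continuous_at by blast

lemma derivative_along_line:
  assumes "x + s *\<^sub>R w \<in> S"
  shows "((\<lambda>s. f (x + s *\<^sub>R w)) has_real_derivative g (x + s *\<^sub>R w) \<bullet> w) (at s)"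
proof -
  have "((\<lambda>s. x + s *\<^sub>R w) has_derivative (\<lambda>h. h *\<^sub>R w)) (at s)"
    by (auto intro!: derivative_eq_intros)
  from has_derivative_compose[OF this has_derivative_grad[OF assms]] show ?thesis
    by (simp add: has_field_derivative_def inner_commute mult_commute_abs)
qed

lemma derivative_grad_along_line:
  assumes "x + s *\<^sub>R w \<in> S"
  shows "((\<lambda>s. g (x + s *\<^sub>R w) \<bullet> a) has_real_derivative H (x + s *\<^sub>R w) w \<bullet> a) (at s)"
proof -
  have "((\<lambda>s. x + s *\<^sub>R w) has_derivative (\<lambda>h. h *\<^sub>R w)) (at s)"
    by (auto intro!: derivative_eq_intros)
  from has_derivative_compose[OF this hess[OF assms]]
  have "((\<lambda>s. g (x + s *\<^sub>R w) \<bullet> a) has_derivative (\<lambda>h. H (x + s *\<^sub>R w) (h *\<^sub>R w) \<bullet> a)) (at s)"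
    by (auto intro!: derivative_eq_intros)
  then show ?thesis
    by (simp add: has_field_derivative_def blinfun.scaleR_right
        mult_commute_abs)
qed

lemma second_difference:
  assumes "0 < s"
    and dom: "\<And>\<theta> \<theta>'. \<lbrakk>0 \<le> \<theta>; \<theta> \<le> s; 0 \<le> \<theta>'; \<theta>' \<le> s\<rbrakk> \<Longrightarrow> x + \<theta> *\<^sub>R a + \<theta>' *\<^sub>R b \<in> S"
  obtains \<theta> \<theta>' where "0 < \<theta>" "\<theta> < s" "0 < \<theta>'" "\<theta>' < s"
    "f (x + s *\<^sub>R a + s *\<^sub>R b) - f (x + s *\<^sub>R a) - f (x + s *\<^sub>R b) + f x
      = s\<^sup>2 * (H (x + \<theta> *\<^sub>R a + \<theta>' *\<^sub>R b) b \<bullet> a)"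
proof -
  let ?F = "\<lambda>\<theta>. f (x + s *\<^sub>R b + \<theta> *\<^sub>R a) - f (x + \<theta> *\<^sub>R a)"
  have "\<exists>\<theta>>0. \<theta> < s \<and> ?F s - ?F 0 = (s - 0) * (g (x + s *\<^sub>R b + \<theta> *\<^sub>R a) \<bullet> a - g (x + \<theta> *\<^sub>R a) \<bullet> a)"
  proof (rule MVT2[OF \<open>0 < s\<close>])
    fix \<theta> assume "0 \<le> \<theta>" "\<theta> \<le> s"
    then have "x + s *\<^sub>R b + \<theta> *\<^sub>R a \<in> S" "x + \<theta> *\<^sub>R a \<in> S"
      using dom[of \<theta> s] dom[of \<theta> 0] \<open>0 < s\<close> by (auto simp: algebra_simps)
    then show "(?F has_real_derivative g (x + s *\<^sub>R b + \<theta> *\<^sub>R a) \<bullet> a - g (x + \<theta> *\<^sub>R a) \<bullet> a) (at \<theta>)"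
      by (intro DERIV_diff derivative_along_line)
  qed
  then obtain \<theta> where \<theta>: "0 < \<theta>" "\<theta> < s"
    "?F s - ?F 0 = s * (g (x + s *\<^sub>R b + \<theta> *\<^sub>R a) \<bullet> a - g (x + \<theta> *\<^sub>R a) \<bullet> a)" by auto
  let ?G = "\<lambda>\<theta>'. g (x + \<theta> *\<^sub>R a + \<theta>' *\<^sub>R b) \<bullet> a"
  have "\<exists>\<theta>'>0. \<theta>' < s \<and> ?G s - ?G 0 = (s - 0) * (H (x + \<theta> *\<^sub>R a + \<theta>' *\<^sub>R b) b \<bullet> a)"
    by (rule MVT2[OF \<open>0 < s\<close>], rule derivative_grad_along_line) (use dom \<theta> in auto)
  then obtain \<theta>' where \<theta>': "0 < \<theta>'" "\<theta>' < s" "?G s - ?G 0 = s * (H (x + \<theta> *\<^sub>R a + \<theta>' *\<^sub>R b) b \<bullet> a)"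
    by auto
  have "f (x + s *\<^sub>R a + s *\<^sub>R b) - f (x + s *\<^sub>R a) - f (x + s *\<^sub>R b) + f x = ?F s - ?F 0"
    by (simp add: algebra_simps)
  also have "\<dots> = s\<^sup>2 * (H (x + \<theta> *\<^sub>R a + \<theta>' *\<^sub>R b) b \<bullet> a)"
    using \<theta>(3) \<theta>'(3) by (simp add: power2_eq_square algebra_simps)
  finally show thesis using that \<theta> \<theta>' by blast
qed

text \<open>Symmetry of the Hessian: the second difference of \<open>f\<close> over a small parallelogram is symmetric
  in its two sides, and it is \<open>s\<^sup>2\<close> times a value of the Hessian form at a nearby point.\<close>

lemma hess_sym:
  assumes "x \<in> S"
  shows "H x a \<bullet> b = H x b \<bullet> a"
proof -
  have ex: "\<exists>y z. (\<forall>p\<in>{y,z}. dist p x \<le> s * (norm a + norm b)) \<and> H y a \<bullet> b = H z b \<bullet> a"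
    if "0 < s" and sub: "cball x (s * (norm a + norm b)) \<subseteq> S" for s
  proof -
    have near: "dist (x + \<theta> *\<^sub>R a' + \<theta>' *\<^sub>R b') x \<le> s * (norm a' + norm b')"
      if "0 \<le> \<theta>" "\<theta> \<le> s" "0 \<le> \<theta>'" "\<theta>' \<le> s" for \<theta> \<theta>' and a' b' :: 'a
    proof -
      have "dist (x + \<theta> *\<^sub>R a' + \<theta>' *\<^sub>R b') x \<le> \<theta> * norm a' + \<theta>' * norm b'"
        using that norm_triangle_ineq[of "\<theta> *\<^sub>R a'" "\<theta>' *\<^sub>R b'"] by (simp add: dist_norm)
      also have "\<dots> \<le> s * norm a' + s * norm b'"
        using that by (intro add_mono mult_right_mono) auto
      finally show ?thesis by (simp add: algebra_simps)
    qed
    obtain \<theta> \<theta>' where 1: "0 < \<theta>" "\<theta> < s" "0 < \<theta>'" "\<theta>' < s"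
      "f (x + s *\<^sub>R a + s *\<^sub>R b) - f (x + s *\<^sub>R a) - f (x + s *\<^sub>R b) + f x
        = s\<^sup>2 * (H (x + \<theta> *\<^sub>R a + \<theta>' *\<^sub>R b) b \<bullet> a)"
      by (rule second_difference[OF \<open>0 < s\<close>, of x a b])
        (use near[of _ _ a b] sub in \<open>auto simp: dist_commute subset_iff\<close>)
    obtain \<eta> \<eta>' where 2: "0 < \<eta>" "\<eta> < s" "0 < \<eta>'" "\<eta>' < s"
      "f (x + s *\<^sub>R b + s *\<^sub>R a) - f (x + s *\<^sub>R b) - f (x + s *\<^sub>R a) + f x
        = s\<^sup>2 * (H (x + \<eta> *\<^sub>R b + \<eta>' *\<^sub>R a) a \<bullet> b)"
      by (rule second_difference[OF \<open>0 < s\<close>, of x b a])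
        (use near[of _ _ b a] sub in \<open>auto simp: dist_commute subset_iff add.commute[of "norm b"]\<close>)
    have "f (x + s *\<^sub>R b + s *\<^sub>R a) = f (x + s *\<^sub>R a + s *\<^sub>R b)"
      by (simp add: add.commute add.left_commute)
    then have "s\<^sup>2 * (H (x + \<eta> *\<^sub>R b + \<eta>' *\<^sub>R a) a \<bullet> b)
        = s\<^sup>2 * (H (x + \<theta> *\<^sub>R a + \<theta>' *\<^sub>R b) b \<bullet> a)"
      using 1(5) 2(5) by linarith
    then show ?thesis
      using \<open>0 < s\<close> near[of \<theta> \<theta>' a b] near[of \<eta> \<eta>' b a] 1(1-4) 2(1-4)
      by (intro exI[of _ "x + \<eta> *\<^sub>R b + \<eta>' *\<^sub>R a"] exI[of _ "x + \<theta> *\<^sub>R a + \<theta>' *\<^sub>R b"])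
        (auto simp: add.commute[of "norm b"])
  qed
  show ?thesis
  proof (rule ccontr)
    assume ne: "H x a \<bullet> b \<noteq> H x b \<bullet> a"
    define \<epsilon> where "\<epsilon> = \<bar>H x a \<bullet> b - H x b \<bullet> a\<bar> / 2"
    have "0 < \<epsilon>" using ne by (simp add: \<epsilon>_def)
    have c: "\<forall>\<^sub>F y in nhds x. \<bar>H y a' \<bullet> b' - H x a' \<bullet> b'\<bar> < \<epsilon>" for a' b'
    proof -
      have "isCont (\<lambda>y. H y a' \<bullet> b') x"
        using isCont_hess[OF assms] by (intro continuous_intros)
      then have "((\<lambda>y. H y a' \<bullet> b') \<longlongrightarrow> H x a' \<bullet> b') (nhds x)"
        unfolding isCont_def
        by (rule tendsto_at_iff_tendsto_nhds[of "\<lambda>y. H y a' \<bullet> b'", THEN iffD1])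
      from tendstoD[OF this \<open>0 < \<epsilon>\<close>] show ?thesis by (simp add: dist_real_def)
    qed
    have "\<forall>\<^sub>F y in nhds x. y \<in> S \<and> \<bar>H y a \<bullet> b - H x a \<bullet> b\<bar> < \<epsilon> \<and> \<bar>H y b \<bullet> a - H x b \<bullet> a\<bar> < \<epsilon>"
      using c[of a b] c[of b a] eventually_nhds_in_open[OF open_dom assms]
      by eventually_elim simp
    then obtain d where d: "0 < d" "\<And>y. dist y x < d \<Longrightarrow>
        y \<in> S \<and> \<bar>H y a \<bullet> b - H x a \<bullet> b\<bar> < \<epsilon> \<and> \<bar>H y b \<bullet> a - H x b \<bullet> a\<bar> < \<epsilon>"
      by (auto simp: eventually_nhds_metric)
    define s where "s = d / (2 * (norm a + norm b + 1))"
    have "0 < s" using d(1) by (auto simp: s_def intro!: divide_pos_pos add_nonneg_pos)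
    have "s * (norm a + norm b) \<le> s * (norm a + norm b + 1)"
      using \<open>0 < s\<close> by simp
    also have "\<dots> = d / 2"
      using add_nonneg_pos[of "norm a + norm b" 1] by (simp add: s_def field_simps)
    finally have sd: "s * (norm a + norm b) < d" using d(1) by simp
    obtain y z where "\<forall>p\<in>{y,z}. dist p x \<le> s * (norm a + norm b)" "H y a \<bullet> b = H z b \<bullet> a"
      using ex[OF \<open>0 < s\<close>] d(2) sd by (auto simp: subset_iff dist_commute)
    then have "\<bar>H y a \<bullet> b - H x a \<bullet> b\<bar> < \<epsilon>" "\<bar>H y a \<bullet> b - H x b \<bullet> a\<bar> < \<epsilon>"
      using d(2)[of y] d(2)[of z] sd by auto
    then show False by (simp add: \<epsilon>_def abs_if split: if_splits)
  qed
qed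

end

section \<open>Second-order superjets\<close>

text \<open>The pairs \<open>(d, K)\<close> form the second-order superjet of viscosity theory. The length of the gradient of a
  \<open>C\<^sup>2\<close> function need not be twice differentiable, but second-order inequalities for it can be
  expressed through these pairs.\<close>
definition superjet :: "('a::euclidean_space \<Rightarrow> real) \<Rightarrow> 'a \<Rightarrow> 'a \<Rightarrow> ('a \<Rightarrow> 'a) \<Rightarrow> bool" where
  "superjet f x d K \<longleftrightarrow> (\<forall>\<delta>>0. \<forall>\<^sub>F y in nhds x.
     f y \<le> f x + d \<bullet> (y - x) + K (y - x) \<bullet> (y - x) / 2 + \<delta> * (norm (y - x))\<^sup>2)"

lemma superjet_C2:
  fixes f :: "'a::euclidean_space \<Rightarrow> real"
  assumes "open S" "x \<in> S" and "\<And>y. y \<in> S \<Longrightarrow> GDERIV f y :> g y" and "(g has_derivative A) (at x)"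
  shows "superjet f x (g x) A"
  unfolding superjet_def
proof (intro allI impI)
  fix \<delta> :: real assume "0 < \<delta>"
  then have "\<forall>\<^sub>F y in nhds x. \<bar>f y - (f x + g x \<bullet> (y - x) + A (y - x) \<bullet> (y - x) / 2)\<bar>
      \<le> \<delta> * (norm (y - x))\<^sup>2"
    by (intro taylor_peano[OF assms(1,2)]) (use assms in auto)
  then show "\<forall>\<^sub>F y in nhds x. f y \<le> f x + g x \<bullet> (y - x) + A (y - x) \<bullet> (y - x) / 2 + \<delta> * (norm (y - x))\<^sup>2"
    by (rule eventually_mono) linarith
qed

lemma superjet_mono:
  assumes "superjet h x d K" and "\<forall>\<^sub>F y in nhds x. f y - f x \<le> h y - h x"
  shows "superjet f x d K"
  unfolding superjet_def
proof (intro allI impI)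
  fix \<delta> :: real assume "0 < \<delta>"
  then have "\<forall>\<^sub>F y in nhds x. h y \<le> h x + d \<bullet> (y - x) + K (y - x) \<bullet> (y - x) / 2 + \<delta> * (norm (y - x))\<^sup>2"
    using assms(1) by (simp add: superjet_def)
  with assms(2) show "\<forall>\<^sub>F y in nhds x. f y \<le> f x + d \<bullet> (y - x) + K (y - x) \<bullet> (y - x) / 2 + \<delta> * (norm (y - x))\<^sup>2"
    by eventually_elim simp
qed

lemma superjet_gradient:
  fixes f :: "'a::euclidean_space \<Rightarrow> real"
  assumes "superjet f x d K" "linear K" "(f has_derivative D) (at x)"
  shows "D w = d \<bullet> w"
proof -
  let ?F = "\<lambda>y. f y - (f x + d \<bullet> (y - x) + K (y - x) \<bullet> (y - x) / 2 + 1 * ((y - x) \<bullet> (y - x)))"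
  have K: "(K has_derivative K) F" for F
    using assms(2) linear_conv_bounded_linear bounded_linear_imp_has_derivative by blast
  have [derivative_intros]: "((\<lambda>y. K (y - x)) has_derivative (\<lambda>h. K h)) (at x)"
    by (rule has_derivative_compose[OF _ K]) (auto intro!: derivative_eq_intros)
  have "(?F has_derivative (\<lambda>h. D h - d \<bullet> h)) (at x)"
    by (auto intro!: derivative_eq_intros assms(3) simp: linear_0[OF assms(2)])
  moreover have "\<forall>\<^sub>F y in at x. ?F y \<le> ?F x"
  proof -
    have "\<forall>\<^sub>F y in nhds x. f y \<le> f x + d \<bullet> (y - x) + K (y - x) \<bullet> (y - x) / 2 + 1 * (norm (y - x))\<^sup>2"
      using assms(1) unfolding superjet_def by (rule allE[of _ 1]) simp
    then show ?thesis
      by (simp add: eventually_at_filter power2_norm_eq_inner linear_0[OF assms(2)] eventually_mono)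
  qed
  ultimately have "(\<lambda>h. D h - d \<bullet> h) = (\<lambda>v. 0)"
    by (rule has_derivative_local_max)
  then show ?thesis by (metis eq_iff_diff_eq_0)
qed

lemma quadratic_form_bound:
  fixes K :: "'a::euclidean_space \<Rightarrow> 'a"
  assumes "linear K"
  obtains C where "0 < C" "\<And>w. \<bar>K w \<bullet> w\<bar> \<le> C * (norm w)\<^sup>2"
proof -
  from linear_bounded_pos[OF assms] obtain C where C: "0 < C" "\<And>w. norm (K w) \<le> C * norm w" by auto
  have "\<bar>K w \<bullet> w\<bar> \<le> C * (norm w)\<^sup>2" for w
  proof -
    have "\<bar>K w \<bullet> w\<bar> \<le> norm (K w) * norm w" by (rule Cauchy_Schwarz_ineq2)
    also have "\<dots> \<le> C * norm w * norm w" by (intro mult_right_mono C) simp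
    finally show ?thesis by (simp add: power2_eq_square)
  qed
  with C(1) show thesis by (rule that)
qed

text \<open>The product of the two quadratic upper bounds is the expected quadratic polynomial up to terms of
  third order. Nonnegativity of the factors allows the bounds to be multiplied.\<close>
lemma superjet_mult:
  fixes f h :: "'a::euclidean_space \<Rightarrow> real"
  assumes f: "superjet f x d K" and h: "superjet h x d' K'" and lin: "linear K" "linear K'"
    and nonneg: "\<And>y. 0 \<le> f y" "\<And>y. 0 \<le> h y"
  shows "superjet (\<lambda>y. f y * h y) x (f x *\<^sub>R d' + h x *\<^sub>R d)
    (\<lambda>w. f x *\<^sub>R K' w + h x *\<^sub>R K w + (d \<bullet> w) *\<^sub>R d' + (d' \<bullet> w) *\<^sub>R d)"
  unfolding superjet_def
proof (intro allI impI)
  fix \<delta> :: real assume "0 < \<delta>"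
  define \<epsilon> where "\<epsilon> = \<delta> / (2 * (f x + h x + 1))"
  have den: "0 < f x + h x + 1" using nonneg[of x] by simp
  have "0 < \<epsilon>" using \<open>0 < \<delta>\<close> den by (simp add: \<epsilon>_def)
  have \<epsilon>\<delta>: "(f x + h x) * \<epsilon> \<le> \<delta> / 2"
  proof -
    have "(f x + h x) * \<epsilon> \<le> (f x + h x + 1) * \<epsilon>" using \<open>0 < \<epsilon>\<close> by simp
    also have "\<dots> = \<delta> / 2" using den by (simp add: \<epsilon>_def field_simps)
    finally show ?thesis .
  qed
  obtain C where C: "0 < C" "\<And>w. \<bar>K w \<bullet> w\<bar> \<le> C * (norm w)\<^sup>2"
    using quadratic_form_bound[OF lin(1)] by blast
  obtain C' where C': "0 < C'" "\<And>w. \<bar>K' w \<bullet> w\<bar> \<le> C' * (norm w)\<^sup>2"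
    using quadratic_form_bound[OF lin(2)] by blast
  define M where "M = C + C' + \<epsilon>"
  define L where "L = norm d * M + norm d' * M + M\<^sup>2"
  have "0 < M" using C C' \<open>0 < \<epsilon>\<close> by (simp add: M_def)
  then have "0 < L" by (simp add: L_def add_nonneg_pos)
  have "\<forall>\<^sub>F y in nhds x. dist y x < min 1 (\<delta> / (2 * L))"
    using \<open>0 < L\<close> \<open>0 < \<delta>\<close> by (intro eventually_nhds_metric[THEN iffD2]) (auto intro!: exI[of _ "min 1 (\<delta> / (2 * L))"])
  moreover have "\<forall>\<^sub>F y in nhds x. f y \<le> f x + d \<bullet> (y - x) + K (y - x) \<bullet> (y - x) / 2 + \<epsilon> * (norm (y - x))\<^sup>2"
    using f \<open>0 < \<epsilon>\<close> by (simp add: superjet_def)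
  moreover have "\<forall>\<^sub>F y in nhds x. h y \<le> h x + d' \<bullet> (y - x) + K' (y - x) \<bullet> (y - x) / 2 + \<epsilon> * (norm (y - x))\<^sup>2"
    using h \<open>0 < \<epsilon>\<close> by (simp add: superjet_def)
  ultimately show "\<forall>\<^sub>F y in nhds x. f y * h y \<le> f x * h x + (f x *\<^sub>R d' + h x *\<^sub>R d) \<bullet> (y - x)
      + (f x *\<^sub>R K' (y - x) + h x *\<^sub>R K (y - x) + (d \<bullet> (y - x)) *\<^sub>R d' + (d' \<bullet> (y - x)) *\<^sub>R d) \<bullet> (y - x) / 2
      + \<delta> * (norm (y - x))\<^sup>2"
  proof eventually_elim
    case (elim y)
    define w where "w = y - x"
    define N where "N = norm w"
    define \<alpha> where "\<alpha> = K w \<bullet> w / 2 + \<epsilon> * N\<^sup>2"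
    define \<beta> where "\<beta> = K' w \<bullet> w / 2 + \<epsilon> * N\<^sup>2"
    have N: "0 \<le> N" "N \<le> 1" "N \<le> \<delta> / (2 * L)"
      using elim(1) by (auto simp: N_def w_def dist_norm)
    have \<alpha>: "\<bar>\<alpha>\<bar> \<le> M * N\<^sup>2"
    proof -
      have "\<bar>\<alpha>\<bar> \<le> \<bar>K w \<bullet> w\<bar> / 2 + \<epsilon> * N\<^sup>2"
        using \<open>0 < \<epsilon>\<close> unfolding \<alpha>_def by (intro order_trans[OF abs_triangle_ineq]) simp
      also have "\<dots> \<le> C * N\<^sup>2 + C' * N\<^sup>2 + \<epsilon> * N\<^sup>2"
        using C(2)[of w] C(1) C'(1) by (simp add: N_def add_increasing2)
      finally show ?thesis by (simp add: M_def algebra_simps)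
    qed
    have \<beta>: "\<bar>\<beta>\<bar> \<le> M * N\<^sup>2"
    proof -
      have "\<bar>\<beta>\<bar> \<le> \<bar>K' w \<bullet> w\<bar> / 2 + \<epsilon> * N\<^sup>2"
        using \<open>0 < \<epsilon>\<close> unfolding \<beta>_def by (intro order_trans[OF abs_triangle_ineq]) simp
      also have "\<dots> \<le> C * N\<^sup>2 + C' * N\<^sup>2 + \<epsilon> * N\<^sup>2"
        using C'(2)[of w] C(1) C'(1) by (simp add: N_def add_increasing)
      finally show ?thesis by (simp add: M_def algebra_simps)
    qed
    have dw: "\<bar>d \<bullet> w\<bar> \<le> norm d * N" "\<bar>d' \<bullet> w\<bar> \<le> norm d' * N"
      unfolding N_def by (rule Cauchy_Schwarz_ineq2)+
    have "(d \<bullet> w) * \<beta> + (d' \<bullet> w) * \<alpha> + \<alpha> * \<beta>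
        \<le> \<bar>d \<bullet> w\<bar> * \<bar>\<beta>\<bar> + \<bar>d' \<bullet> w\<bar> * \<bar>\<alpha>\<bar> + \<bar>\<alpha>\<bar> * \<bar>\<beta>\<bar>"
      by (intro add_mono) (simp_all flip: abs_mult)
    also have "\<dots> \<le> (norm d * N) * (M * N\<^sup>2) + (norm d' * N) * (M * N\<^sup>2) + (M * N\<^sup>2) * (M * N\<^sup>2)"
      using \<alpha> \<beta> dw \<open>0 < M\<close> N(1) by (intro add_mono mult_mono) auto
    also have "\<dots> \<le> L * N * N\<^sup>2"
    proof -
      have "(M * N\<^sup>2) * (M * N\<^sup>2) = M\<^sup>2 * N\<^sup>2 * (N * N)" by (simp add: power2_eq_square)
      also have "\<dots> \<le> M\<^sup>2 * N\<^sup>2 * (N * 1)" using N by (intro mult_left_mono) auto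
      finally show ?thesis by (simp add: L_def algebra_simps)
    qed
    also have "\<dots> \<le> (\<delta> / 2) * N\<^sup>2"
      using N(3) \<open>0 < L\<close> by (intro mult_right_mono) (auto simp: field_simps)
    finally have cubic: "(d \<bullet> w) * \<beta> + (d' \<bullet> w) * \<alpha> + \<alpha> * \<beta> \<le> (\<delta> / 2) * N\<^sup>2" .
    have "f y \<le> f x + d \<bullet> w + \<alpha>" "h y \<le> h x + d' \<bullet> w + \<beta>"
      using elim by (simp_all add: \<alpha>_def \<beta>_def N_def w_def)
    then have "f y * h y \<le> (f x + d \<bullet> w + \<alpha>) * (h x + d' \<bullet> w + \<beta>)"
      using nonneg[of y] by (intro mult_mono) auto
    also have "\<dots> = f x * h x + f x * (d' \<bullet> w) + h x * (d \<bullet> w)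
        + (f x * (K' w \<bullet> w) + h x * (K w \<bullet> w) + 2 * (d \<bullet> w) * (d' \<bullet> w)) / 2
        + ((f x + h x) * \<epsilon>) * N\<^sup>2 + ((d \<bullet> w) * \<beta> + (d' \<bullet> w) * \<alpha> + \<alpha> * \<beta>)"
      by (simp add: \<alpha>_def \<beta>_def field_simps)
    also have "\<dots> \<le> f x * h x + f x * (d' \<bullet> w) + h x * (d \<bullet> w)
        + (f x * (K' w \<bullet> w) + h x * (K w \<bullet> w) + 2 * (d \<bullet> w) * (d' \<bullet> w)) / 2 + (\<delta> / 2) * N\<^sup>2 + (\<delta> / 2) * N\<^sup>2"
      using cubic mult_right_mono[OF \<epsilon>\<delta>, of "N\<^sup>2"] by simp
    finally show ?case
      by (simp add: inner_add_left field_simps flip: w_def N_def)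
  qed
qed

lemma superjet_norm_affine:
  fixes e x :: "'a::euclidean_space"
  assumes "norm e = 1"
  shows "superjet (\<lambda>y. norm (e + \<kappa> *\<^sub>R (y - x))) x (\<kappa> *\<^sub>R e) (\<lambda>w. \<kappa>\<^sup>2 *\<^sub>R (w - (w \<bullet> e) *\<^sub>R e))"
proof -
  let ?S = "{y. e + \<kappa> *\<^sub>R (y - x) \<noteq> 0}"
  let ?g = "\<lambda>y. \<kappa> *\<^sub>R (e + \<kappa> *\<^sub>R (y - x)) /\<^sub>R norm (e + \<kappa> *\<^sub>R (y - x))"
  have "e \<noteq> 0" using assms by auto
  have "superjet (\<lambda>y. norm (e + \<kappa> *\<^sub>R (y - x))) x (?g x) (\<lambda>w. \<kappa>\<^sup>2 *\<^sub>R (w - (w \<bullet> e) *\<^sub>R e))"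
  proof (rule superjet_C2[where S = ?S and g = ?g])
    show "open ?S" by (intro open_Collect_neq continuous_intros)
    show "x \<in> ?S" using \<open>e \<noteq> 0\<close> by simp
    show "GDERIV (\<lambda>y. norm (e + \<kappa> *\<^sub>R (y - x))) y :> ?g y" if "y \<in> ?S" for y
    proof -
      have "((\<lambda>y. norm (e + \<kappa> *\<^sub>R (y - x))) has_derivative
          (\<lambda>h. (\<kappa> *\<^sub>R h) \<bullet> sgn (e + \<kappa> *\<^sub>R (y - x)))) (at y)"
        by (rule has_derivative_compose[of "\<lambda>y. e + \<kappa> *\<^sub>R (y - x)", OF _ has_derivative_norm])
          (use that in \<open>auto intro!: derivative_eq_intros\<close>)
      then show ?thesis by (simp add: gderiv_def sgn_div_norm mult.commute mult.left_commute)
    qed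
    have "((\<lambda>y. e + \<kappa> *\<^sub>R (y - x)) has_derivative (\<lambda>h. \<kappa> *\<^sub>R h)) (at x)"
      by (auto intro!: derivative_eq_intros)
    from has_derivative_compose[OF this has_derivative_norm]
    have "((\<lambda>y. norm (e + \<kappa> *\<^sub>R (y - x))) has_derivative (\<lambda>h. (\<kappa> *\<^sub>R h) \<bullet> e)) (at x)"
      using assms \<open>e \<noteq> 0\<close> by (simp add: sgn_div_norm)
    then show "(?g has_derivative (\<lambda>w. \<kappa>\<^sup>2 *\<^sub>R (w - (w \<bullet> e) *\<^sub>R e))) (at x)"
      using assms \<open>e \<noteq> 0\<close>
      by (auto intro!: derivative_eq_intros simp: power2_eq_square algebra_simps)
  qed
  then show ?thesis using assms by simp
qed

section \<open>The maximum principle for the length of the gradient\<close>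

text \<open>The derivative of \<open>V p_trace p g H - (n - 1)|g|\<^sup>4\<close> in the direction \<open>(c, k, K)\<close>, and below it the
  difference quotient of the same expression for a step \<open>t\<close>.\<close>
definition linearized ::
  "real \<Rightarrow> real \<Rightarrow> 'a::euclidean_space \<Rightarrow> ('a \<Rightarrow> 'a) \<Rightarrow> real \<Rightarrow> 'a \<Rightarrow> ('a \<Rightarrow> 'a) \<Rightarrow> real" where
  "linearized p V g H c k K = c * p_trace p g H
     + V * (2 * (g \<bullet> k) * tr H + (p - 2) * (H g \<bullet> k + H k \<bullet> g) + p_trace p g K)
     - 4 * (real DIM('a) - 1) * (g \<bullet> g) * (g \<bullet> k)"

definition increment :: "real \<Rightarrow> real \<Rightarrow> 'a::euclidean_space \<Rightarrow> ('a \<Rightarrow> 'a) \<Rightarrow> real \<Rightarrow> real \<Rightarrow> 'a \<Rightarrow> ('a \<Rightarrow> 'a) \<Rightarrow> real" where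
  "increment p V g H t c k K = (let s = 2 * (g \<bullet> k) + t * (k \<bullet> k) in
     c * p_trace p g H
     + (V + t * c) * (s * tr H + (g \<bullet> g) * tr K + t * (s * tr K)
         + (p - 2) * (K g \<bullet> g + H g \<bullet> k + H k \<bullet> g
             + t * (K g \<bullet> k + K k \<bullet> g + H k \<bullet> k) + t\<^sup>2 * (K k \<bullet> k)))
     - (real DIM('a) - 1) * (2 * (g \<bullet> g) * s + t * s\<^sup>2))"

lemma equation_increment:
  fixes g k :: "'a::euclidean_space"
  assumes "linear H" "linear K"
  shows "(V + t * c) * p_trace p (g + t *\<^sub>R k) (\<lambda>w. H w + t *\<^sub>R K w)
      - (real DIM('a) - 1) * ((g + t *\<^sub>R k) \<bullet> (g + t *\<^sub>R k))\<^sup>2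
    = V * p_trace p g H - (real DIM('a) - 1) * (g \<bullet> g)\<^sup>2 + t * increment p V g H t c k K"
proof -
  have lin: "H (g + t *\<^sub>R k) = H g + t *\<^sub>R H k" "K (g + t *\<^sub>R k) = K g + t *\<^sub>R K k"
    using assms by (simp_all add: linear_add linear_scale)
  have S: "(g + t *\<^sub>R k) \<bullet> (g + t *\<^sub>R k) = g \<bullet> g + t * (2 * (g \<bullet> k) + t * (k \<bullet> k))"
    by (simp add: inner_add_left inner_add_right inner_commute algebra_simps)
  have Q: "(H (g + t *\<^sub>R k) + t *\<^sub>R K (g + t *\<^sub>R k)) \<bullet> (g + t *\<^sub>R k)
      = H g \<bullet> g + t * (K g \<bullet> g + H g \<bullet> k + H k \<bullet> g
                + t * (K g \<bullet> k + K k \<bullet> g + H k \<bullet> k) + t\<^sup>2 * (K k \<bullet> k))"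
    unfolding lin by (simp add: inner_add_left inner_add_right power2_eq_square algebra_simps)
  show ?thesis
    unfolding p_trace_def Q S tr_add tr_scaleR increment_def Let_def by algebra
qed

lemma tendsto_increment:
  fixes g :: "nat \<Rightarrow> 'a::euclidean_space" and H :: "nat \<Rightarrow> 'a \<Rightarrow>\<^sub>L 'a"
  assumes [tendsto_intros]: "V \<longlonglongrightarrow> V0" "g \<longlonglongrightarrow> g0" "H \<longlonglongrightarrow> H0" "t \<longlonglongrightarrow> 0" "c \<longlonglongrightarrow> c0" "k \<longlonglongrightarrow> k0"
    and "linear K"
  shows "(\<lambda>i. increment p (V i) (g i) (H i) (t i) (c i) (k i) K) \<longlonglongrightarrow> linearized p V0 g0 H0 c0 k0 K"
proof -
  have [tendsto_intros]: "(\<lambda>i. K (Y i)) \<longlonglongrightarrow> K y" if "Y \<longlonglongrightarrow> y" for Y y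
    using \<open>linear K\<close> that bounded_linear.tendsto linear_conv_bounded_linear by blast
  have [tendsto_intros]: "(\<lambda>i. tr (H i)) \<longlonglongrightarrow> tr H0"
    unfolding tr_def by (intro tendsto_intros)
  show ?thesis
    unfolding increment_def Let_def linearized_def p_trace_def
    by (rule tendsto_eq_rhs, (rule tendsto_intros)+) (simp add: algebra_simps)
qed

lemma p_trace_scale:
  assumes "linear H"
  shows "p_trace p (a *\<^sub>R g) (\<lambda>w. b *\<^sub>R H w) = a\<^sup>2 * b * p_trace p g H"
  using assms by (simp add: p_trace_def tr_scaleR linear_scale power2_eq_square algebra_simps)

text \<open>This is the equation of \<open>v = u\<^sup>-\<^sup>1\<^sup>/\<^sup>q\<close> for a \<open>p\<close>-harmonic \<open>u\<close>. The exponent is the one for which the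
  fundamental solution of the \<open>p\<close>-Laplacian becomes the cone \<open>|x|\<close>. The equation is invariant under
  translations and dilations of the variable, since both sides scale with the fourth power of the dilation
  factor.\<close>
locale cone_equation = C2_function S v g H
  for S :: "'a::euclidean_space set" and v g H +
  fixes p :: real
  assumes p_gt_1: "1 < p"
    and v_pos: "x \<in> S \<Longrightarrow> 0 < v x"
    and equation: "x \<in> S \<Longrightarrow> v x * p_trace p (g x) (H x) = (real DIM('a) - 1) * (g x \<bullet> g x)\<^sup>2"
begin

text \<open>Joint continuity in the base point and the direction is what the limit of moving maximum points
  in \<open>linearized_nonneg\<close> requires.\<close>
lemma difference_quotient_limit:
  assumes "y \<in> S" and "Y \<longlonglongrightarrow> y" and "t \<longlonglongrightarrow> 0" and t_pos: "\<And>i. 0 < t i" and "E \<longlonglongrightarrow> e"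
  shows "(\<lambda>i. (v (Y i + t i *\<^sub>R E i) - v (Y i)) / t i) \<longlonglongrightarrow> g y \<bullet> e"
proof -
  obtain \<rho> where \<rho>: "0 < \<rho>" "ball y \<rho> \<subseteq> S" using open_dom assms(1) openE by blast
  have "(\<lambda>i. Y i + t i *\<^sub>R E i) \<longlonglongrightarrow> y + 0 *\<^sub>R e" by (intro tendsto_intros assms)
  then have ev: "\<forall>\<^sub>F i in sequentially. Y i \<in> ball y \<rho> \<and> Y i + t i *\<^sub>R E i \<in> ball y \<rho>"
    using tendstoD[OF \<open>Y \<longlonglongrightarrow> y\<close> \<rho>(1)] tendstoD[of _ y sequentially \<rho>] \<rho>(1)
    by (auto simp: dist_commute eventually_conj_iff)
  have "\<exists>s. 0 < s \<and> s < t i \<and> (v (Y i + t i *\<^sub>R E i) - v (Y i)) = t i * (g (Y i + s *\<^sub>R E i) \<bullet> E i)"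
    if "Y i \<in> ball y \<rho> \<and> Y i + t i *\<^sub>R E i \<in> ball y \<rho>" for i
  proof -
    have "\<exists>s>0. s < t i \<and> v (Y i + t i *\<^sub>R E i) - v (Y i + 0 *\<^sub>R E i) = (t i - 0) * (g (Y i + s *\<^sub>R E i) \<bullet> E i)"
    proof (rule MVT2[OF t_pos])
      fix s assume s: "0 \<le> s" "s \<le> t i"
      have "Y i + s *\<^sub>R E i = (1 - s / t i) *\<^sub>R Y i + (s / t i) *\<^sub>R (Y i + t i *\<^sub>R E i)"
        using t_pos[of i] by (simp add: algebra_simps)
      also have "\<dots> \<in> ball y \<rho>"
        using that s t_pos[of i] by (intro convexD[OF convex_ball]) auto
      finally show "((\<lambda>s. v (Y i + s *\<^sub>R E i)) has_real_derivative g (Y i + s *\<^sub>R E i) \<bullet> E i) (at s)"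
        using \<rho>(2) by (intro derivative_along_line) auto
    qed
    then show ?thesis by auto
  qed
  then obtain s where s: "\<And>i. Y i \<in> ball y \<rho> \<and> Y i + t i *\<^sub>R E i \<in> ball y \<rho> \<Longrightarrow>
      0 < s i \<and> s i < t i \<and> (v (Y i + t i *\<^sub>R E i) - v (Y i)) = t i * (g (Y i + s i *\<^sub>R E i) \<bullet> E i)"
    by metis
  have "s \<longlonglongrightarrow> 0"
  proof (rule tendsto_sandwich[OF _ _ tendsto_const \<open>t \<longlonglongrightarrow> 0\<close>])
    show "\<forall>\<^sub>F i in sequentially. 0 \<le> s i"
      using ev by eventually_elim (use s in \<open>force intro: less_imp_le\<close>)
    show "\<forall>\<^sub>F i in sequentially. s i \<le> t i"
      using ev by eventually_elim (use s in \<open>force intro: less_imp_le\<close>)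
  qed
  then have "(\<lambda>i. Y i + s i *\<^sub>R E i) \<longlonglongrightarrow> y + 0 *\<^sub>R e" by (intro tendsto_intros assms)
  then have "(\<lambda>i. g (Y i + s i *\<^sub>R E i)) \<longlonglongrightarrow> g y"
    using isCont_tendsto_compose[OF isCont_grad[OF assms(1)]] by simp
  then have "(\<lambda>i. g (Y i + s i *\<^sub>R E i) \<bullet> E i) \<longlonglongrightarrow> g y \<bullet> e" by (intro tendsto_intros assms)
  moreover have "\<forall>\<^sub>F i in sequentially. g (Y i + s i *\<^sub>R E i) \<bullet> E i = (v (Y i + t i *\<^sub>R E i) - v (Y i)) / t i"
    using ev
  proof eventually_elim
    case (elim i)
    with s[OF elim] t_pos[of i] show ?case by simp
  qed
  ultimately show ?thesis by (rule Lim_transform_eventually)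
qed

lemma quotient_gradient:
  assumes "t \<noteq> 0" and "y \<in> S" and "y + t *\<^sub>R (e + \<kappa> *\<^sub>R (y - x)) \<in> S"
  shows "GDERIV (\<lambda>y. (v (y + t *\<^sub>R (e + \<kappa> *\<^sub>R (y - x))) - v y) / t) y
    :> ((1 + t * \<kappa>) *\<^sub>R g (y + t *\<^sub>R (e + \<kappa> *\<^sub>R (y - x))) - g y) /\<^sub>R t"
proof -
  have "((\<lambda>y. y + t *\<^sub>R (e + \<kappa> *\<^sub>R (y - x))) has_derivative (\<lambda>h. (1 + t * \<kappa>) *\<^sub>R h)) (at y)"
    by (auto intro!: derivative_eq_intros simp: algebra_simps)
  from has_derivative_compose[OF this has_derivative_grad[OF assms(3)]] show ?thesis
    unfolding gderiv_def
    by (auto intro!: derivative_eq_intros has_derivative_grad assms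
        simp: divide_inverse inner_diff_right algebra_simps)
qed

lemma quotient_hessian:
  assumes "t \<noteq> 0" and "y \<in> S" and "y + t *\<^sub>R (e + \<kappa> *\<^sub>R (y - x)) \<in> S"
  shows "((\<lambda>y. ((1 + t * \<kappa>) *\<^sub>R g (y + t *\<^sub>R (e + \<kappa> *\<^sub>R (y - x))) - g y) /\<^sub>R t) has_derivative
    (\<lambda>w. ((1 + t * \<kappa>)\<^sup>2 *\<^sub>R H (y + t *\<^sub>R (e + \<kappa> *\<^sub>R (y - x))) w - H y w) /\<^sub>R t)) (at y)"
proof -
  have "((\<lambda>y. y + t *\<^sub>R (e + \<kappa> *\<^sub>R (y - x))) has_derivative (\<lambda>h. (1 + t * \<kappa>) *\<^sub>R h)) (at y)"
    by (auto intro!: derivative_eq_intros simp: algebra_simps)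
  from has_derivative_compose[OF this hess[OF assms(3)]] show ?thesis
    by (auto intro!: derivative_eq_intros hess assms
        simp: blinfun.scaleR_right power2_eq_square)
qed

text \<open>The function \<open>w y = (e + \<kappa>(y - x)) \<bullet> g y\<close> is a derivative of \<open>v\<close> along a one-parameter family of dilations
  (translations if \<open>\<kappa> = 0\<close>), so formally it solves the linearized equation, and a quadratic polynomial touching it from
  above is a subsolution at the point of contact. As \<open>v\<close> has two derivatives only, \<open>w\<close> is replaced
  by the quotients \<open>(v(y + t(e + \<kappa>(y - x))) - v y)/t\<close>. These are \<open>C\<^sup>2\<close>, and both functions
  in the numerator solve the same nonlinear equation. At a maximum point of quotient minus
  polynomial the two equations can be subtracted, and \<open>t\<close> then tends to \<open>0\<close>.\<close>
lemma linearized_nonneg: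
  assumes "x \<in> S" and sj: "superjet (\<lambda>y. (e + \<kappa> *\<^sub>R (y - x)) \<bullet> g y) x k K" and "linear K"
    and sym: "\<And>a b. K a \<bullet> b = K b \<bullet> a"
  shows "0 \<le> linearized p (v x) (g x) (H x) (e \<bullet> g x) k K"
proof -
  define c where "c = e \<bullet> g x"
  define E where "E y = e + \<kappa> *\<^sub>R (y - x)" for y
  have core: "0 \<le> linearized p (v x) (g x) (H x) c k (\<lambda>w. K w + (2 * \<delta>) *\<^sub>R w)" if "0 < \<delta>" for \<delta>
  proof -
    \<comment> \<open>The added multiple of the identity makes the contact at \<open>x\<close> strict, so that maximum points converge to \<open>x\<close>.\<close>
    define L where "L w = K w + (2 * \<delta>) *\<^sub>R w" for w
    have linL: "linear L"
      unfolding L_def using \<open>linear K\<close> by (intro linear_compose_add linear_compose_scale_right linear_ident)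
    have symL: "L a \<bullet> b = L b \<bullet> a" for a b
      by (simp add: L_def inner_add_left sym[of a b] inner_commute[of a b])
    define \<psi> where "\<psi> y = c + k \<bullet> (y - x) + L (y - x) \<bullet> (y - x) / 2" for y
    have \<psi>_eq: "\<psi> y = c + k \<bullet> (y - x) + K (y - x) \<bullet> (y - x) / 2 + \<delta> * (norm (y - x))\<^sup>2" for y
      by (simp add: \<psi>_def L_def inner_add_left power2_norm_eq_inner add_divide_distrib)
    have "\<forall>\<^sub>F y in nhds x. E y \<bullet> g y \<le> c + k \<bullet> (y - x) + K (y - x) \<bullet> (y - x) / 2 + (\<delta> / 2) * (norm (y - x))\<^sup>2"
      using sj that unfolding superjet_def E_def c_def by (auto dest!: spec[of _ "\<delta> / 2"])
    moreover have "\<forall>\<^sub>F y in nhds x. y \<in> S" by (rule eventually_nhds_in_open[OF open_dom \<open>x \<in> S\<close>])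
    ultimately have "\<forall>\<^sub>F y in nhds x. y \<in> S \<and> E y \<bullet> g y \<le> \<psi> y - (\<delta> / 2) * (norm (y - x))\<^sup>2"
      by eventually_elim (simp add: \<psi>_eq)
    then obtain r where r: "0 < r" "\<And>y. dist y x < r \<Longrightarrow> y \<in> S"
      "\<And>y. dist y x < r \<Longrightarrow> E y \<bullet> g y \<le> \<psi> y - (\<delta> / 2) * (norm (y - x))\<^sup>2"
      unfolding eventually_nhds_metric by blast
    define \<rho> where "\<rho> = r / 2"
    define B where "B = norm e + \<bar>\<kappa>\<bar> * \<rho> + 1"
    define t where "t i = (\<rho> / B) * inverse (real (Suc i))" for i
    have "0 < \<rho>" using r by (simp add: \<rho>_def)
    then have "0 < B" by (simp add: B_def add_nonneg_pos)
    have t_pos: "0 < t i" for i using \<open>0 < \<rho>\<close> \<open>0 < B\<close> by (simp add: t_def)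
    have t_le: "t i * B \<le> \<rho>" for i
    proof -
      have "t i * B = \<rho> * inverse (real (Suc i))" using \<open>0 < B\<close> by (simp add: t_def)
      also have "\<dots> \<le> \<rho> * 1" using \<open>0 < \<rho>\<close> by (intro mult_left_mono) (auto simp: inverse_le_1_iff)
      finally show ?thesis by simp
    qed
    have t_lim: "t \<longlonglongrightarrow> 0"
      unfolding t_def by (rule tendsto_mult_right_zero[OF LIMSEQ_inverse_real_of_nat])
    have stay: "y \<in> S" "y + t i *\<^sub>R E y \<in> S" if "dist y x \<le> \<rho>" for i y
    proof -
      show "y \<in> S" using that r(2)[of y] \<open>0 < \<rho>\<close> by (simp add: \<rho>_def)
      have "norm (E y) \<le> norm e + \<bar>\<kappa>\<bar> * norm (y - x)"
        unfolding E_def by (intro order_trans[OF norm_triangle_ineq]) simp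
      also have "\<dots> < B"
        using that mult_left_mono[of "norm (y - x)" \<rho> "\<bar>\<kappa>\<bar>"] by (simp add: B_def dist_norm)
      finally have "t i * norm (E y) < \<rho>"
        using t_le[of i] mult_strict_left_mono[OF _ t_pos[of i]] by fastforce
      moreover have "dist (y + t i *\<^sub>R E y) x \<le> norm (y - x) + norm (t i *\<^sub>R E y)"
        using norm_triangle_ineq[of "y - x" "t i *\<^sub>R E y"] by (simp add: dist_norm algebra_simps)
      ultimately show "y + t i *\<^sub>R E y \<in> S"
        using that t_pos[of i] by (intro r(2)) (simp add: \<rho>_def dist_norm)
    qed
    define q where "q i y = (v (y + t i *\<^sub>R E y) - v y) / t i" for i y
    define G where "G i y = ((1 + t i * \<kappa>) *\<^sub>R g (y + t i *\<^sub>R E y) - g y) /\<^sub>R t i - (k + L (y - x))" for i y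
    define A where "A i y w = ((1 + t i * \<kappa>)\<^sup>2 *\<^sub>R H (y + t i *\<^sub>R E y) w - H y w) /\<^sub>R t i - L w" for i y w
    have L_der: "((\<lambda>y. L (y - x)) has_derivative (\<lambda>h. L h)) (at y)" for y
    proof -
      have "(L has_derivative L) (at (y - x))"
        using linL linear_conv_bounded_linear bounded_linear_imp_has_derivative by blast
      then show ?thesis
        by (rule has_derivative_compose[rotated]) (auto intro!: derivative_eq_intros)
    qed
    have \<psi>_der: "GDERIV \<psi> y :> k + L (y - x)" for y
      unfolding gderiv_def \<psi>_def
      by (auto intro!: derivative_eq_intros L_der
          simp: inner_add_right inner_commute symL[of _ "y - x"])
    have q_der: "GDERIV (\<lambda>y. q i y - \<psi> y) y :> G i y" if "dist y x \<le> \<rho>" for i y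
      unfolding q_def G_def E_def
      using stay(1)[OF that] stay(2)[OF that, of i] t_pos[of i] by (intro GDERIV_diff \<psi>_der quotient_gradient) (auto simp: E_def)
    have G_der: "(G i has_derivative A i y) (at y)" if "dist y x \<le> \<rho>" for i y
    proof -
      have "((\<lambda>y. ((1 + t i * \<kappa>) *\<^sub>R g (y + t i *\<^sub>R E y) - g y) /\<^sub>R t i) has_derivative
          (\<lambda>w. ((1 + t i * \<kappa>)\<^sup>2 *\<^sub>R H (y + t i *\<^sub>R E y) w - H y w) /\<^sub>R t i)) (at y)"
        unfolding E_def using stay(1)[OF that] stay(2)[OF that, of i] t_pos[of i]
        by (intro quotient_hessian) (auto simp: E_def)
      from has_derivative_diff[OF this has_derivative_add[OF has_derivative_const L_der]]
      show ?thesis by (simp add: G_def[abs_def] A_def[abs_def])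
    qed
    have "\<exists>z\<in>cball x \<rho>. \<forall>y\<in>cball x \<rho>. q i y - \<psi> y \<le> q i z - \<psi> z" for i
    proof (rule continuous_attains_sup)
      show "continuous_on (cball x \<rho>) (\<lambda>y. q i y - \<psi> y)"
        using q_der[of _ i] unfolding gderiv_def
        by (intro continuous_at_imp_continuous_on ballI)
          (auto simp: dist_commute intro: has_derivative_continuous)
    qed (use \<open>0 < \<rho>\<close> in auto)
    then obtain X where X: "\<And>i. X i \<in> cball x \<rho>"
      "\<And>i y. y \<in> cball x \<rho> \<Longrightarrow> q i y - \<psi> y \<le> q i (X i) - \<psi> (X i)" by metis
    obtain l s where l: "l \<in> cball x \<rho>" "strict_mono s" "(X \<circ> s) \<longlonglongrightarrow> l"
      using compact_cball[of x \<rho>] X(1) unfolding compact_def by meson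
    have ts_lim: "(\<lambda>j. t (s j)) \<longlonglongrightarrow> 0"
      using LIMSEQ_subseq_LIMSEQ[OF t_lim l(2)] by (simp add: comp_def)
    have q_lim: "(\<lambda>j. q (s j) (Y j)) \<longlonglongrightarrow> E y \<bullet> g y" if "y \<in> cball x \<rho>" "Y \<longlonglongrightarrow> y" for Y y
      unfolding q_def inner_commute[of "E y"]
      by (rule difference_quotient_limit[OF _ that(2) ts_lim t_pos])
        (use that stay(1)[of y] in \<open>auto simp: E_def dist_commute intro!: tendsto_intros\<close>)
    have \<psi>_lim: "(\<lambda>j. \<psi> (Y j)) \<longlonglongrightarrow> \<psi> y" if "Y \<longlonglongrightarrow> y" for Y y
      using \<psi>_der[of y] that unfolding gderiv_def
      by (blast intro: has_derivative_continuous isCont_tendsto_compose)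
    have Xs: "(\<lambda>j. X (s j)) \<longlonglongrightarrow> l" using l(3) by (simp add: comp_def)
    have "E x \<bullet> g x - \<psi> x \<le> E l \<bullet> g l - \<psi> l"
    proof (rule LIMSEQ_le)
      show "(\<lambda>j. q (s j) x - \<psi> x) \<longlonglongrightarrow> E x \<bullet> g x - \<psi> x"
        using \<open>0 < \<rho>\<close> by (intro tendsto_diff q_lim \<psi>_lim tendsto_const) auto
      show "(\<lambda>j. q (s j) (X (s j)) - \<psi> (X (s j))) \<longlonglongrightarrow> E l \<bullet> g l - \<psi> l"
        by (intro tendsto_diff q_lim \<psi>_lim Xs l)
      show "\<exists>N. \<forall>j\<ge>N. q (s j) x - \<psi> x \<le> q (s j) (X (s j)) - \<psi> (X (s j))"
        using X(2)[of x] \<open>0 < \<rho>\<close> by auto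
    qed
    moreover have "E x \<bullet> g x = \<psi> x"
      by (simp add: E_def \<psi>_def c_def linear_0[OF linL])
    moreover have "E l \<bullet> g l \<le> \<psi> l - (\<delta> / 2) * (norm (l - x))\<^sup>2"
      using l(1) \<open>0 < \<rho>\<close> by (intro r(3)) (auto simp: \<rho>_def dist_commute)
    ultimately have "(\<delta> / 2) * (norm (l - x))\<^sup>2 \<le> 0" by linarith
    then have "l = x" using that by (simp add: mult_le_0_iff)
    define inc where "inc j = increment p (v (X (s j))) (g (X (s j))) (H (X (s j)))
      (t (s j)) (q (s j) (X (s j))) (k + L (X (s j) - x)) L" for j
    \<comment> \<open>The dilated function has gradient \<open>a g z\<close> and Hessian \<open>a\<^sup>2 H z\<close> at \<open>y\<close>, and satisfies the
      equation there because the factor \<open>a\<^sup>4\<close> cancels.\<close>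
    have inc_nonneg: "0 \<le> inc j" if near: "X (s j) \<in> ball x \<rho>" for j
    proof -
      define y where "y = X (s j)"
      define \<tau> where "\<tau> = t (s j)"
      define a where "a = 1 + \<tau> * \<kappa>"
      define z where "z = y + \<tau> *\<^sub>R E y"
      have "0 < \<tau>" by (simp add: \<tau>_def t_pos)
      have y_ball: "y \<in> ball x \<rho>" using near by (simp add: y_def)
      then have yz: "y \<in> S" "z \<in> S"
        using stay(1)[of y] stay(2)[of y "s j"] by (auto simp: z_def \<tau>_def dist_commute)
      have "\<forall>\<^sub>F y' in nhds y. q (s j) y' - \<psi> y' \<le> q (s j) y - \<psi> y"
        using eventually_nhds_in_open[OF open_ball y_ball]
        by eventually_elim (use X(2)[of _ "s j"] in \<open>auto simp: y_def\<close>)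
      note max = local_max_second_order[OF open_ball y_ball _ _ this, where g = "G (s j)" and A = "A (s j) y"]
      have "G (s j) y = 0"
        by (rule max(1)) (use q_der G_der y_ball in \<open>auto simp: dist_commute\<close>)
      moreover have "A (s j) y w \<bullet> w \<le> 0" for w
        by (rule max(2)) (use q_der G_der y_ball in \<open>auto simp: dist_commute\<close>)
      ultimately have grad_z: "a *\<^sub>R g z = g y + \<tau> *\<^sub>R (k + L (y - x))"
        and hess_z: "\<And>w. (a\<^sup>2 *\<^sub>R H z w) \<bullet> w \<le> (H y w + \<tau> *\<^sub>R L w) \<bullet> w"
      proof -
        assume "G (s j) y = 0"
        then have "(a *\<^sub>R g z - g y) /\<^sub>R \<tau> = k + L (y - x)" by (simp add: G_def a_def \<tau>_def z_def)
        then have "\<tau> *\<^sub>R ((a *\<^sub>R g z - g y) /\<^sub>R \<tau>) = \<tau> *\<^sub>R (k + L (y - x))" by simp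
        then have "a *\<^sub>R g z - g y = \<tau> *\<^sub>R (k + L (y - x))" using \<open>0 < \<tau>\<close> by simp
        then show "a *\<^sub>R g z = g y + \<tau> *\<^sub>R (k + L (y - x))" by (metis add.commute diff_add_cancel)
      next
        fix w assume "\<And>w. A (s j) y w \<bullet> w \<le> 0"
        from this[of w] have "((a\<^sup>2 *\<^sub>R H z w) \<bullet> w - H y w \<bullet> w) / \<tau> \<le> L w \<bullet> w"
          by (simp add: A_def a_def \<tau>_def z_def inner_diff_left divide_inverse mult.commute)
        then show "(a\<^sup>2 *\<^sub>R H z w) \<bullet> w \<le> (H y w + \<tau> *\<^sub>R L w) \<bullet> w"
          using \<open>0 < \<tau>\<close> by (simp add: inner_add_left pos_divide_le_eq mult.commute)
      qed
      have lin: "linear (\<lambda>w. H y w)" "linear (\<lambda>w. H z w)"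
        by (simp_all add: blinfun.bounded_linear_right bounded_linear.linear)
      have vz: "v z = v y + \<tau> * q (s j) y"
        using \<open>0 < \<tau>\<close> by (simp add: q_def z_def \<tau>_def)
      have "(real DIM('a) - 1) * ((a *\<^sub>R g z) \<bullet> (a *\<^sub>R g z))\<^sup>2
          = a ^ 4 * ((real DIM('a) - 1) * (g z \<bullet> g z)\<^sup>2)"
        by (simp add: power2_eq_square power4_eq_xxxx algebra_simps)
      also have "\<dots> = v z * p_trace p (a *\<^sub>R g z) (\<lambda>w. a\<^sup>2 *\<^sub>R H z w)"
        unfolding equation[OF yz(2), symmetric] p_trace_scale[OF lin(2)]
        by (simp add: power2_eq_square power4_eq_xxxx)
      also have "\<dots> \<le> v z * p_trace p (a *\<^sub>R g z) (\<lambda>w. H y w + \<tau> *\<^sub>R L w)"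
        using v_pos[OF yz(2)] hess_z p_gt_1 lin linL
        by (intro mult_left_mono p_trace_mono linear_compose_add linear_compose_scale_right) auto
      finally have "0 \<le> v z * p_trace p (a *\<^sub>R g z) (\<lambda>w. H y w + \<tau> *\<^sub>R L w)
          - (real DIM('a) - 1) * ((a *\<^sub>R g z) \<bullet> (a *\<^sub>R g z))\<^sup>2" by simp
      also have "\<dots> = v y * p_trace p (g y) (H y) - (real DIM('a) - 1) * (g y \<bullet> g y)\<^sup>2 + \<tau> * inc j"
        unfolding grad_z vz inc_def y_def[symmetric] \<tau>_def[symmetric]
        by (rule equation_increment[OF lin(1) linL])
      also have "\<dots> = \<tau> * inc j" using equation[OF yz(1)] by simp
      finally show ?thesis using \<open>0 < \<tau>\<close> by (simp add: zero_le_mult_iff)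
    qed
    have Xx: "(\<lambda>j. X (s j)) \<longlonglongrightarrow> x" using Xs \<open>l = x\<close> by simp
    have L_lim: "(\<lambda>j. L (Y j)) \<longlonglongrightarrow> L y" if "Y \<longlonglongrightarrow> y" for Y y
      using linL that bounded_linear.tendsto linear_conv_bounded_linear by blast
    have k_lim: "(\<lambda>j. k + L (X (s j) - x)) \<longlonglongrightarrow> k"
      using tendsto_add[OF tendsto_const L_lim[OF tendsto_diff[OF Xx tendsto_const]], of k x] linear_0[OF linL]
      by simp
    have "inc \<longlonglongrightarrow> linearized p (v x) (g x) (H x) c k L"
      unfolding inc_def
      using isCont_tendsto_compose[OF isCont_grad[OF \<open>x \<in> S\<close>] Xx]
        isCont_tendsto_compose[OF has_derivative_continuous[OF has_derivative_grad[OF \<open>x \<in> S\<close>]] Xx]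
        isCont_tendsto_compose[OF isCont_hess[OF \<open>x \<in> S\<close>] Xx] q_lim[OF _ Xx] \<open>0 < \<rho>\<close> ts_lim k_lim linL
      by (intro tendsto_increment) (simp_all add: E_def c_def)
    moreover have "\<forall>\<^sub>F j in sequentially. 0 \<le> inc j"
      using tendstoD[OF Xx \<open>0 < \<rho>\<close>] by eventually_elim (simp add: inc_nonneg dist_commute)
    ultimately show ?thesis
      unfolding L_def by (intro tendsto_lowerbound) auto
  qed
  have "(\<lambda>\<delta>. linearized p (v x) (g x) (H x) c k (\<lambda>w. K w + (2 * \<delta>) *\<^sub>R w))
      = (\<lambda>\<delta>. linearized p (v x) (g x) (H x) c k K
          + \<delta> * (2 * v x * (real DIM('a) + p - 2) * (g x \<bullet> g x)))"
    by (simp add: fun_eq_iff linearized_def p_trace_def tr_simps inner_add_left algebra_simps)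
  moreover have "((\<lambda>\<delta>. linearized p (v x) (g x) (H x) c k K
          + \<delta> * (2 * v x * (real DIM('a) + p - 2) * (g x \<bullet> g x))) \<longlongrightarrow> linearized p (v x) (g x) (H x) c k K) (at_right 0)"
    by (auto intro!: tendsto_eq_intros)
  ultimately have lim: "((\<lambda>\<delta>. linearized p (v x) (g x) (H x) c k (\<lambda>w. K w + (2 * \<delta>) *\<^sub>R w))
      \<longlongrightarrow> linearized p (v x) (g x) (H x) c k K) (at_right 0)" by simp
  have "0 \<le> linearized p (v x) (g x) (H x) c k K"
    by (rule tendsto_lowerbound[OF lim]) (use core in \<open>auto simp: eventually_at_filter\<close>)
  then show ?thesis by (simp add: c_def)
qed

text \<open>The differential inequality for the length \<open>P\<close> of the gradient. Test fields \<open>e + \<kappa>(y - x)\<close> satisfy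
  \<open>(e + \<kappa>(y - x)) \<bullet> g y \<le> |e + \<kappa>(y - x)| P\<close>, with equality at \<open>x\<close> for the unit vector \<open>e\<close> in direction \<open>g x\<close>;
  so the product of the superjets on the right is a superjet of the left side, and \<open>linearized_nonneg\<close> applies to it.
  The choice \<open>\<kappa> = P/v\<close> is the radial field of the cone that matches \<open>v\<close> at \<open>x\<close> to first order. With it all
  terms without \<open>d\<close> and \<open>\<Phi>\<close> cancel, as they must because cones have \<open>P\<close> constant.\<close>
lemma length_superjet:
  fixes x
  defines "e \<equiv> sgn (g x)" and "P \<equiv> norm (g x)"
  assumes "x \<in> S" "g x \<noteq> 0" and sj: "superjet (\<lambda>y. norm (g y)) x d \<Phi>" and "linear \<Phi>"
    and sym: "\<And>a b. \<Phi> a \<bullet> b = \<Phi> b \<bullet> a"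
  shows "H x e = d"
    and "0 \<le> v x * P * p_trace p e \<Phi> + 2 * (p - 2) * v x * (d \<bullet> d - (d \<bullet> e)\<^sup>2)
      - 2 * (real DIM('a) - p) * P\<^sup>2 * (d \<bullet> e)"
proof -
  have "0 < P" and ne: "norm e = 1" and ee: "e \<bullet> e = 1" and gx: "g x = P *\<^sub>R e"
    using \<open>g x \<noteq> 0\<close> by (simp_all add: e_def P_def norm_sgn sgn_div_norm dot_square_norm)
  have "0 < v x" using v_pos \<open>x \<in> S\<close> .
  define \<kappa> where "\<kappa> = P / v x"
  (* P is differentiable at x, so the first-order part of a superjet is its gradient. *)
  have "((\<lambda>y. norm (g y)) has_derivative (\<lambda>w. H x w \<bullet> e)) (at x)"
    using has_derivative_compose[OF hess[OF \<open>x \<in> S\<close>] has_derivative_norm[OF \<open>g x \<noteq> 0\<close>]]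
    by (simp add: e_def)
  from superjet_gradient[OF sj \<open>linear \<Phi>\<close> this] have "H x w \<bullet> e = d \<bullet> w" for w .
  then have "H x e \<bullet> w = d \<bullet> w" for w
    using hess_sym[OF \<open>x \<in> S\<close>, of e w] by simp
  then show He: "H x e = d" by (metis vector_eq_rdot inner_commute)
  let ?N = "\<lambda>w. \<kappa>\<^sup>2 *\<^sub>R (w - (w \<bullet> e) *\<^sub>R e)"
  let ?k = "norm (e + \<kappa> *\<^sub>R (x - x)) *\<^sub>R d + norm (g x) *\<^sub>R \<kappa> *\<^sub>R e"
  let ?K = "\<lambda>w. norm (e + \<kappa> *\<^sub>R (x - x)) *\<^sub>R \<Phi> w + norm (g x) *\<^sub>R ?N w
      + ((\<kappa> *\<^sub>R e) \<bullet> w) *\<^sub>R d + (d \<bullet> w) *\<^sub>R \<kappa> *\<^sub>R e"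
  have linN: "linear ?N"
    by (intro linearI) (simp_all add: inner_add_left algebra_simps)
  have "superjet (\<lambda>y. norm (e + \<kappa> *\<^sub>R (y - x)) * norm (g y)) x ?k ?K"
    by (rule superjet_mult[OF superjet_norm_affine[OF ne] sj linN \<open>linear \<Phi>\<close>]) auto
  then have "superjet (\<lambda>y. (e + \<kappa> *\<^sub>R (y - x)) \<bullet> g y) x ?k ?K"
  proof (rule superjet_mono)
    have "(e + \<kappa> *\<^sub>R (y - x)) \<bullet> g y - (e + \<kappa> *\<^sub>R (x - x)) \<bullet> g x
        \<le> norm (e + \<kappa> *\<^sub>R (y - x)) * norm (g y) - norm (e + \<kappa> *\<^sub>R (x - x)) * norm (g x)" for y
      using norm_cauchy_schwarz[of "e + \<kappa> *\<^sub>R (y - x)" "g y"] ne ee \<open>0 < P\<close> by (simp add: gx)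
    then show "\<forall>\<^sub>F y in nhds x. (e + \<kappa> *\<^sub>R (y - x)) \<bullet> g y - (e + \<kappa> *\<^sub>R (x - x)) \<bullet> g x
        \<le> norm (e + \<kappa> *\<^sub>R (y - x)) * norm (g y) - norm (e + \<kappa> *\<^sub>R (x - x)) * norm (g x)"
      by (intro always_eventually allI)
  qed
  then have "0 \<le> linearized p (v x) (g x) (H x) (e \<bullet> g x) ?k ?K"
  proof (rule linearized_nonneg[OF \<open>x \<in> S\<close>])
    show "linear ?K"
      using \<open>linear \<Phi>\<close> by (intro linearI) (simp_all add: linear_add linear_scale inner_add_left inner_add_right algebra_simps)
    show "?K a \<bullet> b = ?K b \<bullet> a" for a b
      using sym[of a b] by (simp add: inner_add_left inner_diff_left inner_commute algebra_simps)
  qed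
  then have main: "0 \<le> linearized p (v x) (P *\<^sub>R e) (H x) P (d + (P * \<kappa>) *\<^sub>R e)
      (\<lambda>w. \<Phi> w + (P * \<kappa>\<^sup>2) *\<^sub>R (w - (w \<bullet> e) *\<^sub>R e) + (\<kappa> * (e \<bullet> w)) *\<^sub>R d + (\<kappa> * (d \<bullet> w)) *\<^sub>R e)"
    using ne ee \<open>0 < P\<close> unfolding gx by (simp add: mult.commute)
  define \<eta> where "\<eta> = d \<bullet> e"
  have trH: "tr (H x) = (real DIM('a) - 1) * P\<^sup>2 / v x - (p - 2) * \<eta>"
  proof -
    have "v x * (P\<^sup>2 * (tr (H x) + (p - 2) * \<eta>)) = (real DIM('a) - 1) * P ^ 4"
      using equation[OF \<open>x \<in> S\<close>]
      by (simp add: gx p_trace_def blinfun.scaleR_right He \<eta>_def ee power2_eq_square power4_eq_xxxx algebra_simps)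
    then have "P\<^sup>2 * (v x * (tr (H x) + (p - 2) * \<eta>)) = P\<^sup>2 * ((real DIM('a) - 1) * P\<^sup>2)"
      by (simp add: power2_eq_square power4_eq_xxxx algebra_simps)
    then have "v x * (tr (H x) + (p - 2) * \<eta>) = (real DIM('a) - 1) * P\<^sup>2"
      using \<open>0 < P\<close> by simp
    then show ?thesis using \<open>0 < v x\<close> by (simp add: field_simps)
  qed
  have Hd: "H x d \<bullet> e = d \<bullet> d"
    using hess_sym[OF \<open>x \<in> S\<close>, of d e] by (simp add: He)
  have trK: "tr (\<lambda>w. \<Phi> w + (P * \<kappa>\<^sup>2) *\<^sub>R (w - (w \<bullet> e) *\<^sub>R e) + (\<kappa> * (e \<bullet> w)) *\<^sub>R d + (\<kappa> * (d \<bullet> w)) *\<^sub>R e)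
      = tr \<Phi> + P * \<kappa>\<^sup>2 * (real DIM('a) - 1) + 2 * \<kappa> * \<eta>"
    by (simp add: tr_simps ee \<eta>_def inner_commute[of _ "_ :: 'a"] inner_commute[of e d])
  have "linearized p (v x) (P *\<^sub>R e) (H x) P (d + (P * \<kappa>) *\<^sub>R e)
      (\<lambda>w. \<Phi> w + (P * \<kappa>\<^sup>2) *\<^sub>R (w - (w \<bullet> e) *\<^sub>R e) + (\<kappa> * (e \<bullet> w)) *\<^sub>R d + (\<kappa> * (d \<bullet> w)) *\<^sub>R e)
    = P * (P\<^sup>2 * (tr (H x) + (p - 2) * \<eta>))
      + v x * (2 * P * (\<eta> + P * \<kappa>) * tr (H x) + (p - 2) * (2 * P * (d \<bullet> d + P * \<kappa> * \<eta>))
          + P\<^sup>2 * (tr \<Phi> + P * \<kappa>\<^sup>2 * (real DIM('a) - 1) + 2 * \<kappa> * \<eta>)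
          + (p - 2) * P\<^sup>2 * (\<Phi> e \<bullet> e + 2 * \<kappa> * \<eta>))
      - 4 * (real DIM('a) - 1) * P\<^sup>2 * (P * (\<eta> + P * \<kappa>))"
    unfolding linearized_def p_trace_def trK
    by (simp add: linear_scale[OF \<open>linear \<Phi>\<close>] blinfun.scaleR_right blinfun.add_right He Hd ee \<eta>_def
        inner_add_left inner_add_right inner_diff_left inner_commute[of e d] power2_eq_square algebra_simps)
  also have "\<dots> = P * (v x * P * (tr \<Phi> + (p - 2) * (\<Phi> e \<bullet> e)) + 2 * (p - 2) * v x * (d \<bullet> d - \<eta>\<^sup>2)
      - 2 * (real DIM('a) - p) * P\<^sup>2 * \<eta>)"
    unfolding trH \<kappa>_def using \<open>0 < v x\<close> by (simp add: field_simps power2_eq_square)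
  finally show "0 \<le> v x * P * p_trace p e \<Phi> + 2 * (p - 2) * v x * (d \<bullet> d - (d \<bullet> e)\<^sup>2)
      - 2 * (real DIM('a) - p) * P\<^sup>2 * (d \<bullet> e)"
    using main \<open>0 < P\<close> by (simp add: p_trace_def ee \<eta>_def zero_le_mult_iff)
qed

end

lemma hessian_compose:
  fixes f :: "'a::euclidean_space \<Rightarrow> real"
  assumes "GDERIV f x :> g x" and "(g has_derivative A) (at x)"
    and "(F' has_real_derivative F'') (at (f x))"
  shows "((\<lambda>y. F' (f y) *\<^sub>R g y) has_derivative
    (\<lambda>w. (F'' * (w \<bullet> g x)) *\<^sub>R g x + F' (f x) *\<^sub>R A w)) (at x)"
proof -
  have "((\<lambda>y. F' (f y)) has_derivative (\<lambda>h. F'' * (h \<bullet> g x))) (at x)"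
    using has_derivative_compose[of f "\<lambda>h. h \<bullet> g x" x UNIV F' "\<lambda>h. F'' * h"] assms(1,3)
    by (simp add: gderiv_def has_field_derivative_def)
  from has_derivative_scaleR[OF this assms(2)] show ?thesis
    by (simp add: add.commute)
qed

lemma p_trace_compose:
  "p_trace p g (\<lambda>w. (a * (w \<bullet> g)) *\<^sub>R g + b *\<^sub>R A w) = a * (p - 1) * (g \<bullet> g)\<^sup>2 + b * p_trace p g A"
  by (simp add: p_trace_def tr_simps inner_add_left power2_eq_square algebra_simps)

lemma p_trace_scale_vector:
  assumes "linear A"
  shows "p_trace p (a *\<^sub>R g) A = a\<^sup>2 * p_trace p g A"
  using assms by (simp add: p_trace_def linear_scale power2_eq_square algebra_simps)

lemma convex_above_tangent:
  fixes f :: "'a::euclidean_space \<Rightarrow> real"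
  assumes "convex_on UNIV f" and "GDERIV f x :> d"
  shows "f x + d \<bullet> (y - x) \<le> f y"
proof -
  have "((\<lambda>s. x + s *\<^sub>R (y - x)) has_derivative (\<lambda>h. h *\<^sub>R (y - x))) (at (0::real))"
    by (auto intro!: derivative_eq_intros)
  from has_derivative_compose[OF this, of f "\<lambda>h. h \<bullet> d"] assms(2)
  have "((\<lambda>s. f (x + s *\<^sub>R (y - x))) has_real_derivative d \<bullet> (y - x)) (at 0)"
    by (simp add: gderiv_def has_field_derivative_def inner_commute mult_commute_abs)
  then have "((\<lambda>s. (f (x + s *\<^sub>R (y - x)) - f x) / s) \<longlongrightarrow> d \<bullet> (y - x)) (at_right 0)"
    by (auto simp: has_field_derivative_iff intro: tendsto_mono[OF at_le])
  moreover have "\<forall>\<^sub>F s in at_right (0::real). (f (x + s *\<^sub>R (y - x)) - f x) / s \<le> f y - f x"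
  proof -
    have "(f (x + s *\<^sub>R (y - x)) - f x) / s \<le> f y - f x" if "0 < s" "s < 1" for s
    proof -
      have "f ((1 - s) *\<^sub>R x + s *\<^sub>R y) \<le> (1 - s) * f x + s * f y"
        using assms(1) that by (intro convex_onD) auto
      moreover have "(1 - s) *\<^sub>R x + s *\<^sub>R y = x + s *\<^sub>R (y - x)" by (simp add: algebra_simps)
      ultimately show ?thesis using that by (simp add: field_simps)
    qed
    then show ?thesis
      by (auto simp: eventually_at_right_field intro!: exI[of _ 1])
  qed
  ultimately have "d \<bullet> (y - x) \<le> f y - f x"
    by (rule tendsto_upperbound) simp
  then show ?thesis by simp
qed

text \<open>Convexity is demanded on the whole space although the equation holds on \<open>S\<close> only: rays and segments between
  points of \<open>S\<close> may pass through the complement.\<close>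
locale convex_exterior_solution = cone_equation S v g H p
  for S :: "'a::euclidean_space set" and v g H p +
  assumes p_less_dim: "p < real DIM('a)"
    and convex: "convex_on UNIV v"
    and bounded_complement: "bounded (- S)"
    and connected_dom: "connected S"
    and v_at_infinity: "filterlim v at_top at_infinity"
    and bounded_grad: "bounded (g ` S)"
begin

lemma support: "x \<in> S \<Longrightarrow> v x + g x \<bullet> (y - x) \<le> v y"
  by (rule convex_above_tangent[OF convex grad])

lemma hess_psd:
  assumes "x \<in> S"
  shows "0 \<le> H x w \<bullet> w"
proof -
  have "- H x w \<bullet> w \<le> 0"
  proof (rule local_max_second_order(2)[OF open_dom assms])
    show "GDERIV (\<lambda>y. g x \<bullet> (y - x) - v y) y :> g x - g y" if "y \<in> S" for y
      using has_derivative_grad[OF that] unfolding gderiv_def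
      by (auto intro!: derivative_eq_intros simp: inner_diff_right inner_commute)
    show "((\<lambda>y. g x - g y) has_derivative (\<lambda>w. - H x w)) (at x)"
      by (auto intro!: derivative_eq_intros hess assms)
    show "\<forall>\<^sub>F y in nhds x. g x \<bullet> (y - x) - v y \<le> g x \<bullet> (x - x) - v x"
      using support[OF assms] by (intro always_eventually allI) (simp add: algebra_simps)
  qed
  then show ?thesis by simp
qed

text \<open>Monotonicity of the gradient of a convex function, for the displacement \<open>t g x\<close>. It yields the growth of
  \<open>|g|\<close> outwards and, once \<open>|g|\<close> is known to be constant, equality of the gradients at the two points.\<close>
lemma grad_forward:
  assumes "x \<in> S" "x + t *\<^sub>R g x \<in> S" "0 < t"
  shows "g x \<bullet> g x \<le> g (x + t *\<^sub>R g x) \<bullet> g x"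
proof -
  have "v x + t * (g x \<bullet> g x) \<le> v (x + t *\<^sub>R g x)"
    using support[OF assms(1), of "x + t *\<^sub>R g x"] by simp
  moreover have "v (x + t *\<^sub>R g x) - t * (g (x + t *\<^sub>R g x) \<bullet> g x) \<le> v x"
    using support[OF assms(2), of x] by (simp add: inner_minus_right)
  ultimately have "t * (g x \<bullet> g x) \<le> t * (g (x + t *\<^sub>R g x) \<bullet> g x)" by simp
  then show ?thesis using assms(3) by simp
qed

lemma norm_grad_forward:
  assumes "x \<in> S" "x + t *\<^sub>R g x \<in> S" "0 < t"
  shows "norm (g x) \<le> norm (g (x + t *\<^sub>R g x))"
proof (cases "g x = 0")
  case False
  have "norm (g x) * norm (g x) \<le> norm (g (x + t *\<^sub>R g x)) * norm (g x)"
    using grad_forward[OF assms] norm_cauchy_schwarz[of "g (x + t *\<^sub>R g x)" "g x"]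
    by (simp add: dot_square_norm power2_eq_square)
  then show ?thesis using False by simp
qed simp

lemma isCont_v: "x \<in> S \<Longrightarrow> isCont v x"
  using has_derivative_continuous[OF has_derivative_grad] .

lemma continuous_on_norm_grad: "T \<subseteq> S \<Longrightarrow> continuous_on T (\<lambda>x. norm (g x))"
  using isCont_grad by (intro continuous_at_imp_continuous_on ballI continuous_intros) auto

text \<open>Superjets of \<open>\<epsilon> v\<^sup>\<beta>\<close> have \<open>d\<close> parallel to the gradient, so the quadratic term in \<open>length_superjet\<close>
  vanishes. What remains is a positive multiple of \<open>\<beta>(p - 1) - (n - p)\<close>, which is negative exactly for
  \<open>\<beta> < q\<close>.\<close>
lemma no_interior_max:
  assumes "x \<in> S" "g x \<noteq> 0" "0 < \<epsilon>" "0 < \<beta>" "\<beta> * (p - 1) < real DIM('a) - p"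
  shows "\<not> (\<forall>\<^sub>F y in nhds x. norm (g y) - \<epsilon> * v y powr \<beta> \<le> norm (g x) - \<epsilon> * v x powr \<beta>)"
proof
  assume max: "\<forall>\<^sub>F y in nhds x. norm (g y) - \<epsilon> * v y powr \<beta> \<le> norm (g x) - \<epsilon> * v x powr \<beta>"
  have V: "0 < v x" by (rule v_pos[OF assms(1)])
  define P where "P = norm (g x)"
  define e where "e = sgn (g x)"
  define b where "b = \<epsilon> * \<beta> * v x powr (\<beta> - 1)"
  define a where "a = b * (\<beta> - 1) / v x"
  have "0 < P" "0 < b" using assms V by (simp_all add: P_def b_def)
  have gx: "g x = P *\<^sub>R e" and ee: "e \<bullet> e = 1"
    using assms(2) by (simp_all add: P_def e_def sgn_div_norm dot_square_norm)
  define \<Phi> where "\<Phi> w = (a * (w \<bullet> g x)) *\<^sub>R g x + b *\<^sub>R H x w" for w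
  have lin: "linear \<Phi>"
    by (intro linearI) (simp_all add: \<Phi>_def inner_add_left blinfun.add_right blinfun.scaleR_right algebra_simps)
  have "superjet (\<lambda>y. \<epsilon> * v y powr \<beta>) x ((\<epsilon> * \<beta> * v x powr (\<beta> - 1)) *\<^sub>R g x) \<Phi>"
  proof (rule superjet_C2[where S = S and g = "\<lambda>y. (\<epsilon> * \<beta> * v y powr (\<beta> - 1)) *\<^sub>R g y"])
    show "GDERIV (\<lambda>y. \<epsilon> * v y powr \<beta>) y :> (\<epsilon> * \<beta> * v y powr (\<beta> - 1)) *\<^sub>R g y" if "y \<in> S" for y
      using DERIV_cmult[OF has_real_derivative_powr[OF v_pos[OF that]], of \<epsilon> \<beta>]
      by (intro GDERIV_DERIV_compose[OF grad[OF that]]) (simp add: mult.assoc)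
    have "((\<lambda>s. \<epsilon> * \<beta> * s powr (\<beta> - 1)) has_real_derivative a) (at (v x))"
    proof -
      have "a = \<epsilon> * \<beta> * ((\<beta> - 1) * v x powr (\<beta> - 1 - 1))"
        using V by (simp add: a_def b_def powr_diff power2_eq_square)
      then show ?thesis
        using DERIV_cmult[OF has_real_derivative_powr[OF V], of "\<epsilon> * \<beta>" "\<beta> - 1"] by (simp only:)
    qed
    from hessian_compose[OF grad[OF assms(1)] hess[OF assms(1)] this]
    show "((\<lambda>y. (\<epsilon> * \<beta> * v y powr (\<beta> - 1)) *\<^sub>R g y) has_derivative \<Phi>) (at x)"
      by (simp add: \<Phi>_def[abs_def] b_def)
  qed (use open_dom assms in auto)
  then have "superjet (\<lambda>y. norm (g y)) x (b *\<^sub>R g x) \<Phi>"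
    unfolding b_def by (rule superjet_mono) (use max in \<open>auto elim: eventually_mono\<close>)
  moreover have "\<Phi> w \<bullet> w' = \<Phi> w' \<bullet> w" for w w'
    using hess_sym[OF assms(1), of w w'] by (simp add: \<Phi>_def inner_add_left inner_commute[of "g x"])
  ultimately have "0 \<le> v x * P * p_trace p e \<Phi> + 2 * (p - 2) * v x * ((b *\<^sub>R g x) \<bullet> (b *\<^sub>R g x) - ((b *\<^sub>R g x) \<bullet> e)\<^sup>2)
      - 2 * (real DIM('a) - p) * P\<^sup>2 * ((b *\<^sub>R g x) \<bullet> e)"
    unfolding P_def e_def by (intro length_superjet(2) assms lin)
  also have "(b *\<^sub>R g x) \<bullet> (b *\<^sub>R g x) - ((b *\<^sub>R g x) \<bullet> e)\<^sup>2 = 0"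
    by (simp add: gx ee power2_eq_square)
  also have "(b *\<^sub>R g x) \<bullet> e = b * P"
    by (simp add: gx ee)
  also have "p_trace p e \<Phi> = P\<^sup>2 * b / v x * ((\<beta> - 1) * (p - 1) + (real DIM('a) - 1))"
  proof -
    have "P\<^sup>2 * p_trace p e \<Phi> = p_trace p (g x) \<Phi>"
      by (simp add: gx p_trace_scale_vector[OF lin])
    also have "\<dots> = a * (p - 1) * (g x \<bullet> g x)\<^sup>2 + b * p_trace p (g x) (H x)"
      unfolding \<Phi>_def[abs_def] by (rule p_trace_compose)
    also have "p_trace p (g x) (H x) = (real DIM('a) - 1) * (g x \<bullet> g x)\<^sup>2 / v x"
      using equation[OF assms(1)] V by (simp add: field_simps)
    also have "g x \<bullet> g x = P\<^sup>2" by (simp add: P_def dot_square_norm)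
    also have "a * (p - 1) * (P\<^sup>2)\<^sup>2 + b * ((real DIM('a) - 1) * (P\<^sup>2)\<^sup>2 / v x)
        = P\<^sup>2 * (P\<^sup>2 * b / v x * ((\<beta> - 1) * (p - 1) + (real DIM('a) - 1)))"
      using V by (simp add: a_def field_simps power2_eq_square)
    finally have "P\<^sup>2 * p_trace p e \<Phi> = P\<^sup>2 * (P\<^sup>2 * b / v x * ((\<beta> - 1) * (p - 1) + (real DIM('a) - 1)))" .
    then show ?thesis
      using \<open>0 < P\<close> mult_left_cancel[of "P\<^sup>2" "p_trace p e \<Phi>"] by (metis zero_less_power less_irrefl)
  qed
  also have "v x * P * (P\<^sup>2 * b / v x * ((\<beta> - 1) * (p - 1) + (real DIM('a) - 1))) + 2 * (p - 2) * v x * 0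
      - 2 * (real DIM('a) - p) * P\<^sup>2 * (b * P)
      = (b * P ^ 3) * (\<beta> * (p - 1) - (real DIM('a) - p))"
    using V by (simp add: field_simps power2_eq_square power3_eq_cube)
  finally have "0 \<le> (b * P ^ 3) * (\<beta> * (p - 1) - (real DIM('a) - p))" .
  moreover have "0 < b * P ^ 3" using \<open>0 < P\<close> \<open>0 < b\<close> by simp
  ultimately have "0 \<le> \<beta> * (p - 1) - (real DIM('a) - p)"
    unfolding zero_le_mult_iff by linarith
  then show False using assms(5) by simp
qed

text \<open>An exterior domain normally needs a condition at infinity. Here \<open>M + \<epsilon> v\<^sup>\<beta>\<close> dominates the bounded
  function \<open>|g|\<close> far out, because \<open>v\<close> tends to infinity, and \<open>no_interior_max\<close> keeps it dominant; then \<open>\<epsilon>\<close> tends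
  to \<open>0\<close>.\<close>
lemma max_principle_without_infinity:
  assumes R: "- S \<subseteq> ball 0 R" and M: "\<And>x. norm x = R \<Longrightarrow> norm (g x) \<le> M" "0 \<le> M"
    and "R \<le> norm y"
  shows "norm (g y) \<le> M"
proof -
  (* Any exponent strictly between 0 and q would do. *)
  define \<beta> where "\<beta> = (real DIM('a) - p) / (p - 1) / 2"
  have \<beta>: "0 < \<beta>" "\<beta> * (p - 1) < real DIM('a) - p"
  proof -
    have "\<beta> * (p - 1) = (real DIM('a) - p) / 2"
      using p_gt_1 by (simp only: \<beta>_def) (simp add: divide_simps)
    then show "\<beta> * (p - 1) < real DIM('a) - p" using p_less_dim by simp
  qed (use p_gt_1 p_less_dim in \<open>simp add: \<beta>_def\<close>)
  have inS: "x \<in> S" if "R \<le> norm x" for x using R that by (auto simp: subset_iff)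
  have key: "norm (g y) \<le> M + \<epsilon> * v y powr \<beta>" if "0 < \<epsilon>" for \<epsilon>
  proof (rule ccontr)
    define F where "F x = norm (g x) - \<epsilon> * v x powr \<beta>" for x
    assume "\<not> ?thesis"
    then have Fy: "M < F y" by (simp add: F_def)
    obtain C where C: "\<And>x. x \<in> S \<Longrightarrow> norm (g x) \<le> C" "0 < C"
      using bounded_grad by (auto simp: bounded_pos)
    have "\<forall>\<^sub>F x in at_infinity. (C / \<epsilon>) powr (1 / \<beta>) \<le> v x"
      using v_at_infinity by (simp add: filterlim_at_top)
    then obtain R' where R': "\<And>x. R' \<le> norm x \<Longrightarrow> (C / \<epsilon>) powr (1 / \<beta>) \<le> v x"
      by (auto simp: eventually_at_infinity)
    have far: "F x \<le> 0" if "R \<le> norm x" "R' \<le> norm x" for x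
    proof -
      have "C / \<epsilon> = ((C / \<epsilon>) powr (1 / \<beta>)) powr \<beta>"
        using \<beta> \<open>0 < C\<close> \<open>0 < \<epsilon>\<close> by (simp add: powr_powr)
      also have "\<dots> \<le> v x powr \<beta>"
        using R'[OF that(2)] \<beta> by (intro powr_mono2) auto
      finally show ?thesis
        using C(1)[OF inS[OF that(1)]] \<open>0 < \<epsilon>\<close> by (simp add: F_def field_simps)
    qed
    let ?K = "cball (0::'a) (max R' (norm y)) - ball 0 R"
    have "\<exists>x\<in>?K. \<forall>x'\<in>?K. F x' \<le> F x"
    proof (rule continuous_attains_sup)
      show "compact ?K" by (intro compact_diff compact_cball open_ball)
      have "y \<in> ?K" using \<open>R \<le> norm y\<close> by auto
      then show "?K \<noteq> {}" by blast
      have "?K \<subseteq> S" using inS by auto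
      moreover from this have "\<forall>x\<in>?K. v x \<noteq> 0" using v_pos by (metis less_irrefl subsetD)
      ultimately show "continuous_on ?K F"
        unfolding F_def using isCont_v
        by (intro continuous_on_diff continuous_on_norm_grad continuous_on_mult_left continuous_on_powr
            continuous_on_const continuous_at_imp_continuous_on ballI) auto
    qed
    then obtain x where x: "x \<in> ?K" "\<And>x'. x' \<in> ?K \<Longrightarrow> F x' \<le> F x" by blast
    have Fx: "M < F x"
      using x(2)[of y] Fy \<open>R \<le> norm y\<close> by auto
    have xR: "R < norm x"
    proof (rule ccontr)
      assume "\<not> ?thesis"
      then have "norm x = R" using x(1) by auto
      moreover have "0 \<le> \<epsilon> * v x powr \<beta>" using \<open>0 < \<epsilon>\<close> by simp
      ultimately have "F x \<le> M" using M(1)[of x] unfolding F_def by linarith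
      with Fx show False by simp
    qed
    have "x \<in> S" using xR inS by simp
    have "g x \<noteq> 0"
    proof
      assume "g x = 0"
      then have "F x \<le> 0" using \<open>0 < \<epsilon>\<close> by (simp add: F_def)
      with Fx \<open>0 \<le> M\<close> show False by simp
    qed
    have "open (- cball (0::'a) R)" by auto
    moreover have "x \<in> - cball 0 R" using xR by simp
    ultimately have "\<forall>\<^sub>F x' in nhds x. x' \<in> - cball 0 R" by (rule eventually_nhds_in_open)
    then have "\<forall>\<^sub>F x' in nhds x. F x' \<le> F x"
    proof eventually_elim
      case (elim x')
      show ?case
      proof (cases "x' \<in> ?K")
        case False
        then have "F x' \<le> 0" using elim by (intro far) auto
        then show ?thesis using Fx \<open>0 \<le> M\<close> by simp
      qed (rule x(2))
    qed
    then show False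
      using no_interior_max[OF \<open>x \<in> S\<close> \<open>g x \<noteq> 0\<close> \<open>0 < \<epsilon>\<close> \<beta>] by (simp add: F_def)
  qed
  have "((\<lambda>\<epsilon>. M + \<epsilon> * v y powr \<beta>) \<longlongrightarrow> M) (at_right 0)"
    by (auto intro!: tendsto_eq_intros)
  then show ?thesis
    by (rule tendsto_lowerbound) (use key in \<open>auto simp: eventually_at_filter\<close>)
qed

text \<open>Following a nonzero gradient leads out of every ball without decreasing \<open>|g|\<close>, while outside a ball
  \<open>|g|\<close> is bounded by its maximum on the sphere. Hence that maximum is the maximum over all of \<open>S\<close>.\<close>
lemma norm_grad_attains_max:
  obtains x where "x \<in> S" "g x \<noteq> 0" "\<And>y. y \<in> S \<Longrightarrow> norm (g y) \<le> norm (g x)"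
proof -
  obtain R where R: "0 < R" "- S \<subseteq> ball 0 R"
    using bounded_subset_ballD[OF bounded_complement, of 0] by blast
  have inS: "x \<in> S" if "R \<le> norm x" for x using R that by (auto simp: subset_iff)
  have "\<exists>x\<in>sphere 0 R. \<forall>y\<in>sphere 0 R. norm (g y) \<le> norm (g x)"
    using R(1) by (intro continuous_attains_sup continuous_on_norm_grad) (auto intro: inS)
  then obtain x where x: "norm x = R" "\<And>y. norm y = R \<Longrightarrow> norm (g y) \<le> norm (g x)"
    by auto
  have "x \<in> S" using x(1) inS by simp
  have max: "norm (g y) \<le> norm (g x)" if "y \<in> S" for y
  proof (cases "g y = 0")
    case False
    define t where "t = (R + norm y) / norm (g y)"
    have "0 < t" using R(1) False by (simp add: t_def add_pos_nonneg)
    have "R + norm y = norm (t *\<^sub>R g y)" using False R(1) by (simp add: t_def)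
    also have "\<dots> \<le> norm (y + t *\<^sub>R g y) + norm y"
      using norm_triangle_ineq4[of "y + t *\<^sub>R g y" y] by simp
    finally have far: "R \<le> norm (y + t *\<^sub>R g y)" by simp
    have "norm (g y) \<le> norm (g (y + t *\<^sub>R g y))"
      by (rule norm_grad_forward[OF that inS[OF far] \<open>0 < t\<close>])
    also have "\<dots> \<le> norm (g x)"
      by (rule max_principle_without_infinity[OF R(2) x(2) _ far]) auto
    finally show ?thesis .
  qed simp
  moreover have "g x \<noteq> 0"
  proof
    assume "g x = 0"
    have "(v has_derivative (\<lambda>h. 0)) (at y)" if "y \<in> S" for y
      using has_derivative_grad[OF that] max[OF that] \<open>g x = 0\<close> by simp
    from has_derivative_zero_unique_connected[OF open_dom connected_dom this]
    have const: "v y = v x" if "y \<in> S" for y using that \<open>x \<in> S\<close> by blast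
    have "\<forall>\<^sub>F y in at_infinity. v x + 1 \<le> v y"
      using v_at_infinity by (simp add: filterlim_at_top)
    then obtain R' where R': "\<And>y. R' \<le> norm y \<Longrightarrow> v x + 1 \<le> v y"
      by (auto simp: eventually_at_infinity)
    have "0 \<le> max R (max R' 0)" by simp
    then obtain y :: 'a where "norm y = max R (max R' 0)" by (rule vector_choose_size)
    then have "R' \<le> norm y" "R \<le> norm y" by auto
    then show False using R'[of y] const[OF inS[of y]] by simp
  qed
  ultimately show thesis using that \<open>x \<in> S\<close> by blast
qed

text \<open>The barrier of Hopf's lemma. The function \<open>c - \<epsilon>(exp(-\<alpha>|x - z|\<^sup>2) - exp(-\<alpha>|x\<^sub>0 - z|\<^sup>2))\<close> equals \<open>|g|\<close> at \<open>x\<^sub>0\<close> and exceeds it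
  on the boundary of the small ball around \<open>x\<^sub>0\<close>; so \<open>|g|\<close> minus this function has an interior maximum.
  For large \<open>\<alpha>\<close> the second derivatives of the barrier violate the inequality of \<open>length_superjet\<close> there.
  The first-order term of that inequality has a favourable sign since, by convexity, \<open>d \<bullet> e = H e \<bullet> e \<ge> 0\<close>, and the
  term quadratic in \<open>d\<close> is of order \<open>\<epsilon>\<^sup>2\<close>.\<close>
lemma hopf_contradiction:
  assumes sub: "cball x\<^sub>0 \<rho> \<subseteq> S" and "0 < \<rho>" and "\<rho> < dist x\<^sub>0 z" and "g x\<^sub>0 \<noteq> 0"
    and le: "\<And>x. x \<in> cball x\<^sub>0 \<rho> \<Longrightarrow> norm (g x) \<le> norm (g x\<^sub>0)"
    and less: "\<And>x. \<lbrakk>x \<in> cball x\<^sub>0 \<rho>; x \<in> cball z (dist x\<^sub>0 z); x \<noteq> x\<^sub>0\<rbrakk> \<Longrightarrow> norm (g x) < norm (g x\<^sub>0)"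
  shows False
proof -
  define c where "c = norm (g x\<^sub>0)"
  define r where "r = dist x\<^sub>0 z"
  define n where "n = real DIM('a)"
  define \<mu> where "\<mu> = min 1 (p - 1)"
  (* mu bounds the ellipticity constant from below, and r - rho the distance to z on the small ball. *)
  define \<alpha> where "\<alpha> = (n + p) / (\<mu> * (r - \<rho>)\<^sup>2)"
  have "0 < c" using \<open>g x\<^sub>0 \<noteq> 0\<close> by (simp add: c_def)
  have "0 < r - \<rho>" using assms(3) by (simp add: r_def)
  have "0 < \<mu>" "1 < n + p" using p_gt_1 by (auto simp: \<mu>_def n_def)
  have "0 < \<alpha>" using \<open>0 < \<mu>\<close> \<open>1 < n + p\<close> \<open>0 < r - \<rho>\<close> by (simp add: \<alpha>_def)
  obtain \<delta> where \<delta>: "0 < \<delta>" "\<And>x. \<lbrakk>x \<in> sphere x\<^sub>0 \<rho>; x \<in> cball z r\<rbrakk> \<Longrightarrow> norm (g x) \<le> c - \<delta>"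
  proof (cases "sphere x\<^sub>0 \<rho> \<inter> cball z r = {}")
    case True
    show thesis by (rule that[of 1]) (use True in \<open>auto simp: disjoint_iff\<close>)
  next
    case False
    have "\<exists>x\<in>sphere x\<^sub>0 \<rho> \<inter> cball z r. \<forall>y\<in>sphere x\<^sub>0 \<rho> \<inter> cball z r. norm (g y) \<le> norm (g x)"
      using False sub by (intro continuous_attains_sup continuous_on_norm_grad) auto
    then obtain x where x: "x \<in> sphere x\<^sub>0 \<rho> \<inter> cball z r"
      "\<And>y. y \<in> sphere x\<^sub>0 \<rho> \<inter> cball z r \<Longrightarrow> norm (g y) \<le> norm (g x)" by blast
    have "norm (g x) < c"
      unfolding c_def using x(1) \<open>0 < \<rho>\<close> by (intro less) (auto simp: r_def)
    then show thesis using that[of "c - norm (g x)"] x(2) by auto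
  qed
  (* epsilon is small for three purposes: the boundary comparison, |g| >= c/2 at the maximum point,
     and absorbing the term quadratic in the gradient of the barrier, whose size is governed by B. *)
  define B where "B = 8 * \<bar>p - 2\<bar> * \<alpha> * (r + \<rho>)\<^sup>2 + 1"
  define \<epsilon> where "\<epsilon> = min \<delta> (min (c / 2) (c / (2 * B)))"
  have "0 < B" using \<open>0 < \<alpha>\<close> by (simp add: B_def add_nonneg_pos)
  have "0 < \<epsilon>" using \<delta>(1) \<open>0 < c\<close> \<open>0 < B\<close> by (simp add: \<epsilon>_def)
  have \<epsilon>: "\<epsilon> \<le> \<delta>" "\<epsilon> \<le> c / 2" by (simp_all add: \<epsilon>_def)
  have \<epsilon>B: "\<epsilon> * B < c"
  proof -
    have "\<epsilon> * B \<le> c / (2 * B) * B" using \<open>0 < B\<close> by (intro mult_right_mono) (auto simp: \<epsilon>_def)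
    also have "\<dots> < c" using \<open>0 < B\<close> \<open>0 < c\<close> by simp
    finally show ?thesis .
  qed
  define h where "h x = exp (- \<alpha> * ((x - z) \<bullet> (x - z)))" for x
  have h: "0 < h x" "h x \<le> 1" for x using \<open>0 < \<alpha>\<close> by (simp_all add: h_def)
  define F where "F x = norm (g x) + \<epsilon> * h x" for x
  have "\<exists>x\<in>cball x\<^sub>0 \<rho>. \<forall>y\<in>cball x\<^sub>0 \<rho>. F y \<le> F x"
    unfolding F_def h_def using \<open>0 < \<rho>\<close>
    by (intro continuous_attains_sup continuous_on_add continuous_on_norm_grad sub continuous_intros) auto
  then obtain x where x: "x \<in> cball x\<^sub>0 \<rho>" "\<And>y. y \<in> cball x\<^sub>0 \<rho> \<Longrightarrow> F y \<le> F x" by blast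
  have Fx: "c + \<epsilon> * h x\<^sub>0 \<le> F x"
    using x(2)[of x\<^sub>0] \<open>0 < \<rho>\<close> by (simp add: F_def c_def)
  have "x \<in> ball x\<^sub>0 \<rho>"
  proof (rule ccontr)
    assume "x \<notin> ball x\<^sub>0 \<rho>"
    then have sph: "x \<in> sphere x\<^sub>0 \<rho>" using x(1) by auto
    show False
    proof (cases "x \<in> cball z r")
      case True
      have "F x \<le> c - \<delta> + \<epsilon> * 1"
        unfolding F_def using \<delta>(2)[OF sph True] h(2)[of x] \<open>0 < \<epsilon>\<close>
        by (intro add_mono mult_left_mono) auto
      also have "\<dots> < c + \<epsilon> * h x\<^sub>0" using \<epsilon>(1) mult_pos_pos[OF \<open>0 < \<epsilon>\<close> h(1)[of x\<^sub>0]] by linarith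
      finally show False using Fx by simp
    next
      case False
      then have "r\<^sup>2 < (norm (x - z))\<^sup>2"
        using assms(2,3) by (intro power_strict_mono) (auto simp: r_def dist_norm norm_minus_commute)
      then have "h x < h x\<^sub>0"
        using \<open>0 < \<alpha>\<close> by (simp add: h_def r_def dist_norm flip: power2_norm_eq_inner)
      then have "F x < c + \<epsilon> * h x\<^sub>0"
        unfolding F_def using le[OF x(1)] \<open>0 < \<epsilon>\<close> by (simp add: c_def add_le_less_mono)
      then show False using Fx by simp
    qed
  qed
  have "x \<in> S" using x(1) sub by auto
  define P where "P = norm (g x)"
  have "c / 2 \<le> P"
  proof -
    have "c < F x" using Fx h(1)[of x\<^sub>0] \<open>0 < \<epsilon>\<close> by (smt (verit) mult_pos_pos)
    moreover have "\<epsilon> * h x \<le> c / 2"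
      using mult_left_mono[OF h(2)[of x], of \<epsilon>] \<open>0 < \<epsilon>\<close> \<epsilon>(2) by linarith
    ultimately show ?thesis by (simp add: F_def P_def)
  qed
  then have "0 < P" "g x \<noteq> 0" using \<open>0 < c\<close> by (auto simp: P_def)
  define e where "e = sgn (g x)"
  have ee: "e \<bullet> e = 1" "norm e = 1"
    using \<open>g x \<noteq> 0\<close> by (simp_all add: e_def dot_square_norm norm_sgn)
  define y where "y = x - z"
  define \<gamma> where "\<gamma> = \<epsilon> * h x"
  have "0 < \<gamma>" "\<gamma> \<le> \<epsilon>" using h[of x] \<open>0 < \<epsilon>\<close> by (simp_all add: \<gamma>_def mult_left_le)
  define d where "d = (2 * \<alpha> * \<gamma>) *\<^sub>R y"
  define \<Phi> where "\<Phi> w = (- 4 * \<alpha>\<^sup>2 * \<gamma>) *\<^sub>R (w \<bullet> y) *\<^sub>R y + (2 * \<alpha> * \<gamma>) *\<^sub>R w" for w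
  have lin: "linear \<Phi>"
    by (intro linearI) (simp_all add: \<Phi>_def inner_add_left algebra_simps)
  have sq_grad: "GDERIV (\<lambda>x. (x - z) \<bullet> (x - z)) x' :> 2 *\<^sub>R (x' - z)" for x'
    unfolding gderiv_def by (auto intro!: derivative_eq_intros simp: inner_commute algebra_simps)
  have sq_hess: "((\<lambda>x. 2 *\<^sub>R (x - z)) has_derivative (\<lambda>w. 2 *\<^sub>R w)) (at x')" for x'
    by (auto intro!: derivative_eq_intros)
  have "superjet (\<lambda>x. - \<epsilon> * h x) x ((\<epsilon> * \<alpha> * exp (- \<alpha> * ((x - z) \<bullet> (x - z)))) *\<^sub>R 2 *\<^sub>R (x - z)) \<Phi>"
  proof (rule superjet_C2[where S = UNIV and
        g = "\<lambda>x. (\<epsilon> * \<alpha> * exp (- \<alpha> * ((x - z) \<bullet> (x - z)))) *\<^sub>R 2 *\<^sub>R (x - z)"])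
    show "GDERIV (\<lambda>x. - \<epsilon> * h x) x' :> (\<epsilon> * \<alpha> * exp (- \<alpha> * ((x' - z) \<bullet> (x' - z)))) *\<^sub>R 2 *\<^sub>R (x' - z)" for x'
      unfolding h_def by (rule GDERIV_DERIV_compose[OF sq_grad]) (auto intro!: derivative_eq_intros)
    have "((\<lambda>s. \<epsilon> * \<alpha> * exp (- \<alpha> * s)) has_real_derivative - \<alpha>\<^sup>2 * \<gamma>) (at ((x - z) \<bullet> (x - z)))"
      by (auto intro!: derivative_eq_intros simp: \<gamma>_def h_def power2_eq_square)
    from hessian_compose[OF sq_grad sq_hess this]
    show "((\<lambda>x. (\<epsilon> * \<alpha> * exp (- \<alpha> * ((x - z) \<bullet> (x - z)))) *\<^sub>R 2 *\<^sub>R (x - z)) has_derivative \<Phi>) (at x)"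
      by (rule has_derivative_eq_rhs) (simp add: \<Phi>_def fun_eq_iff y_def \<gamma>_def h_def algebra_simps)
  qed auto
  then have "superjet (\<lambda>x. - \<epsilon> * h x) x d \<Phi>"
    by (simp add: d_def \<gamma>_def h_def y_def mult_ac)
  then have sj: "superjet (\<lambda>x. norm (g x)) x d \<Phi>"
  proof (rule superjet_mono)
    show "\<forall>\<^sub>F y in nhds x. norm (g y) - norm (g x) \<le> - \<epsilon> * h y - - \<epsilon> * h x"
      using eventually_nhds_in_open[OF open_ball \<open>x \<in> ball x\<^sub>0 \<rho>\<close>]
    proof eventually_elim
      case (elim y)
      then show ?case using x(2)[of y] by (simp add: F_def)
    qed
  qed
  have sym: "\<Phi> a \<bullet> b = \<Phi> b \<bullet> a" for a b
    by (simp add: \<Phi>_def inner_diff_left inner_commute[of a b] inner_commute[of y])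
  note jet = length_superjet[OF \<open>x \<in> S\<close> \<open>g x \<noteq> 0\<close> sj lin sym, folded e_def P_def]
  have "0 \<le> d \<bullet> e"
    using hess_psd[OF \<open>x \<in> S\<close>, of e] jet(1) by simp
  then have "0 \<le> 2 * (n - p) * P\<^sup>2 * (d \<bullet> e)"
    using p_less_dim by (simp add: n_def)
  then have "0 \<le> v x * (P * p_trace p e \<Phi> + 2 * (p - 2) * (d \<bullet> d - (d \<bullet> e)\<^sup>2))"
    using jet(2) by (simp add: n_def algebra_simps)
  then have main: "0 \<le> P * p_trace p e \<Phi> + 2 * (p - 2) * (d \<bullet> d - (d \<bullet> e)\<^sup>2)"
    using v_pos[OF \<open>x \<in> S\<close>] by (simp add: zero_le_mult_iff)
  have y_low: "(r - \<rho>)\<^sup>2 \<le> y \<bullet> y" and y_up: "y \<bullet> y \<le> (r + \<rho>)\<^sup>2"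
  proof -
    have "dist x\<^sub>0 z \<le> dist x\<^sub>0 x + dist x z" "dist x z \<le> dist x x\<^sub>0 + dist x\<^sub>0 z"
      by (rule dist_triangle)+
    then have "r - \<rho> \<le> norm y" "norm y \<le> r + \<rho>"
      using x(1) by (auto simp: r_def y_def dist_norm norm_minus_commute)
    then show "(r - \<rho>)\<^sup>2 \<le> y \<bullet> y" "y \<bullet> y \<le> (r + \<rho>)\<^sup>2"
      using \<open>0 < r - \<rho>\<close> by (auto simp flip: power2_norm_eq_inner intro!: power_mono)
  qed
  have ye: "(e \<bullet> y)\<^sup>2 \<le> y \<bullet> y"
    using Cauchy_Schwarz_ineq[of e y] ee by simp
  have "\<mu> * (r - \<rho>)\<^sup>2 \<le> y \<bullet> y + (p - 2) * (e \<bullet> y)\<^sup>2"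
  proof (cases "p \<ge> 2")
    case True
    have "\<mu> * (r - \<rho>)\<^sup>2 \<le> 1 * (y \<bullet> y)"
      using y_low \<open>0 < \<mu>\<close> by (intro mult_mono) (auto simp: \<mu>_def)
    then show ?thesis using True by (simp add: add_increasing2)
  next
    case False
    have "(p - 2) * (y \<bullet> y) \<le> (p - 2) * (e \<bullet> y)\<^sup>2"
      using ye False by (intro mult_left_mono_neg) auto
    moreover have "\<mu> * (r - \<rho>)\<^sup>2 \<le> (p - 1) * (y \<bullet> y)"
      using y_low p_gt_1 by (intro mult_mono) (auto simp: \<mu>_def)
    ultimately show ?thesis by (simp add: algebra_simps)
  qed
  then have "4 * \<alpha>\<^sup>2 * \<gamma> * (\<mu> * (r - \<rho>)\<^sup>2) \<le> 4 * \<alpha>\<^sup>2 * \<gamma> * (y \<bullet> y + (p - 2) * (e \<bullet> y)\<^sup>2)"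
    using \<open>0 < \<gamma>\<close> by (intro mult_left_mono) auto
  moreover have "4 * \<alpha>\<^sup>2 * \<gamma> * (\<mu> * (r - \<rho>)\<^sup>2) = 4 * \<alpha> * \<gamma> * (n + p)"
    using \<open>0 < \<mu>\<close> \<open>0 < r - \<rho>\<close> by (simp add: \<alpha>_def power2_eq_square)
  moreover have "p_trace p e \<Phi> = - 4 * \<alpha>\<^sup>2 * \<gamma> * (y \<bullet> y + (p - 2) * (e \<bullet> y)\<^sup>2) + 2 * \<alpha> * \<gamma> * (n + p - 2)"
    unfolding \<Phi>_def[abs_def] p_trace_rank_one_id by (simp add: ee n_def)
  ultimately have "p_trace p e \<Phi> \<le> 2 * \<alpha> * \<gamma> * (n + p - 2) - 4 * \<alpha> * \<gamma> * (n + p)"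
    by simp
  also have "\<dots> = - (2 * \<alpha> * \<gamma> * (n + p + 2))" by (simp add: algebra_simps)
  also have "\<dots> \<le> - (2 * \<alpha> * \<gamma> * 1)"
    using \<open>0 < \<alpha>\<close> \<open>0 < \<gamma>\<close> \<open>1 < n + p\<close> by (intro le_imp_neg_le mult_left_mono) auto
  finally have "P * p_trace p e \<Phi> \<le> P * (- (2 * \<alpha> * \<gamma> * 1))"
    using \<open>0 < P\<close> by (intro mult_left_mono) auto
  also have "\<dots> \<le> c / 2 * (- (2 * \<alpha> * \<gamma> * 1))"
    using \<open>c / 2 \<le> P\<close> \<open>0 < \<alpha>\<close> \<open>0 < \<gamma>\<close> by (intro mult_right_mono_neg) auto
  finally have first: "P * p_trace p e \<Phi> \<le> - (c * \<alpha> * \<gamma>)" by simp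
  have de: "0 \<le> d \<bullet> d - (d \<bullet> e)\<^sup>2" "d \<bullet> d - (d \<bullet> e)\<^sup>2 \<le> d \<bullet> d"
    using Cauchy_Schwarz_ineq[of d e] ee by simp_all
  have "2 * (p - 2) * (d \<bullet> d - (d \<bullet> e)\<^sup>2) \<le> 2 * \<bar>p - 2\<bar> * (d \<bullet> d - (d \<bullet> e)\<^sup>2)"
    by (rule mult_right_mono[OF mult_left_mono[OF abs_ge_self]]) (use de(1) in auto)
  also have "\<dots> \<le> 2 * \<bar>p - 2\<bar> * (d \<bullet> d)"
    using de(2) by (intro mult_left_mono) auto
  also have "\<dots> = (8 * \<bar>p - 2\<bar> * \<alpha> * (y \<bullet> y)) * \<gamma> * (\<alpha> * \<gamma>)"
    by (simp add: d_def power2_eq_square)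
  also have "\<dots> \<le> B * \<epsilon> * (\<alpha> * \<gamma>)"
  proof (intro mult_right_mono mult_mono)
    have "8 * \<bar>p - 2\<bar> * \<alpha> * (y \<bullet> y) \<le> 8 * \<bar>p - 2\<bar> * \<alpha> * (r + \<rho>)\<^sup>2"
      using y_up \<open>0 < \<alpha>\<close> by (intro mult_left_mono) auto
    then show "8 * \<bar>p - 2\<bar> * \<alpha> * (y \<bullet> y) \<le> B" by (simp add: B_def)
  qed (use \<open>0 < B\<close> \<open>0 < \<alpha>\<close> \<open>0 < \<gamma>\<close> \<open>\<gamma> \<le> \<epsilon>\<close> in auto)
  also have "\<dots> < c * (\<alpha> * \<gamma>)"
    using \<epsilon>B \<open>0 < \<alpha>\<close> \<open>0 < \<gamma>\<close> by (intro mult_strict_right_mono) (auto simp: mult.commute)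
  finally show False using first main by (simp add: mult.assoc)
qed

text \<open>A ball with half the radius, tangent from inside at \<open>x\<^sub>0\<close>, meets the larger sphere at \<open>x\<^sub>0\<close> only.\<close>
lemma near_tangency_point:
  fixes z x\<^sub>0 x :: 'a
  assumes "x \<in> cball (midpoint z x\<^sub>0) (dist x\<^sub>0 (midpoint z x\<^sub>0))" "x \<noteq> x\<^sub>0"
  shows "dist x z < dist x\<^sub>0 z"
proof (rule ccontr)
  define a where "a = x - z"
  define b where "b = x\<^sub>0 - z"
  assume "\<not> ?thesis"
  then have ge: "norm b \<le> norm a" by (simp add: a_def b_def dist_norm)
  have "x - midpoint z x\<^sub>0 = a - b /\<^sub>R 2" "x\<^sub>0 - midpoint z x\<^sub>0 = b /\<^sub>R 2"
    by (simp_all add: a_def b_def midpoint_def algebra_simps flip: scaleR_add_left)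
  then have "norm (a - b /\<^sub>R 2) \<le> norm (b /\<^sub>R 2)"
    using assms(1) by (simp add: dist_norm norm_minus_commute)
  then have "(norm (a - b /\<^sub>R 2))\<^sup>2 \<le> (norm (b /\<^sub>R 2))\<^sup>2" by (intro power_mono) auto
  then have ab: "a \<bullet> a \<le> a \<bullet> b"
    unfolding power2_norm_eq_inner by (simp add: inner_diff_left inner_diff_right inner_commute)
  have "b \<bullet> b \<le> a \<bullet> a" using ge by (simp add: norm_le)
  then have "(a - b) \<bullet> (a - b) \<le> 0"
    using ab by (simp add: inner_diff_left inner_diff_right inner_commute)
  then have "a = b" by (metis inner_gt_zero_iff linorder_not_less eq_iff_diff_eq_0)
  then show False using assms(2) by (simp add: a_def b_def)
qed

text \<open>The strong maximum principle. If the set \<open>A\<close> where \<open>|g|\<close> is maximal were not open, a point \<open>z\<close> outside \<open>A\<close>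
  but close to it would be the centre of a ball free of points of \<open>A\<close>, with a nearest point of \<open>A\<close> on its
  boundary. The ball of half the size tangent there contradicts \<open>hopf_contradiction\<close>.\<close>
theorem norm_grad_constant:
  obtains c where "0 < c" "\<And>x. x \<in> S \<Longrightarrow> norm (g x) = c"
proof -
  obtain x\<^sub>1 where x1: "x\<^sub>1 \<in> S" "g x\<^sub>1 \<noteq> 0" "\<And>y. y \<in> S \<Longrightarrow> norm (g y) \<le> norm (g x\<^sub>1)"
    using norm_grad_attains_max by blast
  define c where "c = norm (g x\<^sub>1)"
  define A where "A = {x \<in> S. norm (g x) = c}"
  have "open A"
  proof (subst open_subopen, intro ballI, rule ccontr)
    fix x assume "x \<in> A" and not_nhd: "\<not> (\<exists>T. open T \<and> x \<in> T \<and> T \<subseteq> A)"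
    then have "x \<in> S" by (simp add: A_def)
    then obtain r where r: "0 < r" "cball x r \<subseteq> S"
      using open_dom open_contains_cball by blast
    obtain z where z: "z \<in> ball x (r / 2)" "z \<notin> A"
      using not_nhd r(1) by (metis centre_in_ball half_gt_zero open_ball subsetI)
    define K where "K = {y \<in> cball x r. norm (g y) = c}"
    have "closed K"
      unfolding K_def using r(2) by (intro continuous_closed_preimage_constant continuous_on_norm_grad) auto
    moreover have "x \<in> K" using \<open>x \<in> A\<close> r(1) by (simp add: K_def A_def)
    ultimately obtain y where y: "y \<in> K" "\<And>w. w \<in> K \<Longrightarrow> dist z y \<le> dist z w"
      using distance_attains_inf[of K z] by blast
    have zx: "dist z x < r / 2" using z(1) by (simp add: dist_commute)
    have zy: "dist y z < r / 2" using y(2)[OF \<open>x \<in> K\<close>] zx by (simp add: dist_commute)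
    have "z \<in> S" using z(1) r by auto
    then have "z \<noteq> y" using z(2) y(1) r(2) by (auto simp: K_def A_def)
    have less: "norm (g w) < c" if "dist w z < dist y z" for w
    proof -
      have "dist w x < r"
        using that zx zy dist_triangle[of w x z] by simp
      then have "w \<in> S" "w \<in> cball x r" using r(2) by (auto simp: dist_commute)
      moreover have "w \<notin> K" using y(2)[of w] that by (auto simp: dist_commute)
      ultimately show ?thesis using x1(3)[of w] by (auto simp: K_def c_def)
    qed
    have yx: "dist y x < r"
      using zx zy dist_triangle[of y x z] by simp
    define m where "m = midpoint z y"
    have m: "dist y m = dist y z / 2" "0 < dist y m"
      using \<open>z \<noteq> y\<close> by (simp_all add: m_def dist_midpoint dist_commute)
    define \<rho> where "\<rho> = min (dist y m / 2) (r - dist y x)"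
    show False
    proof (rule hopf_contradiction[of y \<rho> m])
      show sub: "cball y \<rho> \<subseteq> S"
      proof
        fix w assume "w \<in> cball y \<rho>"
        then have "dist w x \<le> r"
          using dist_triangle[of w x y] by (auto simp: \<rho>_def dist_commute)
        then show "w \<in> S" using r(2) by (auto simp: dist_commute)
      qed
      show "0 < \<rho>" "\<rho> < dist y m" using m(2) yx by (auto simp: \<rho>_def min_less_iff_disj)
      have gy: "norm (g y) = c" using y(1) by (simp add: K_def)
      then show "g y \<noteq> 0" using x1(2) by (auto simp: c_def)
      show "norm (g w) \<le> norm (g y)" if "w \<in> cball y \<rho>" for w
        using that sub x1(3)[of w] gy by (auto simp: c_def)
      show "norm (g w) < norm (g y)" if "w \<in> cball y \<rho>" "w \<in> cball m (dist y m)" "w \<noteq> y" for w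
        using less[OF near_tangency_point[of w z y]] that(2,3) gy by (simp add: m_def)
    qed
  qed
  moreover have "open (S - A)"
  proof -
    have "S - A = S \<inter> (\<lambda>x. norm (g x)) -` (- {c})" by (auto simp: A_def)
    then show ?thesis
      using continuous_open_preimage[OF continuous_on_norm_grad[OF subset_refl] open_dom, of "- {c}"] by auto
  qed
  ultimately have "A = {} \<or> S - A = {}"
    using connectedD[OF connected_dom, of A "S - A"] by (auto simp: A_def)
  moreover have "x\<^sub>1 \<in> A" using x1(1) by (simp add: A_def c_def)
  ultimately have "S \<subseteq> A" by auto
  then show thesis
    using that[of c] x1(2) by (auto simp: A_def c_def)
qed

end

section \<open>Rigidity when the gradient has constant length\<close>

context convex_exterior_solution
begin

lemma grad_constant_along_ray:
  assumes c: "\<And>x. x \<in> S \<Longrightarrow> norm (g x) = c" and "x \<in> S" "x + t *\<^sub>R g x \<in> S" "0 < t"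
  shows "g (x + t *\<^sub>R g x) = g x" and "v (x + t *\<^sub>R g x) = v x + t * c\<^sup>2"
proof -
  let ?y = "x + t *\<^sub>R g x"
  have gg: "g x \<bullet> g x = c\<^sup>2" "g ?y \<bullet> g ?y = c\<^sup>2"
    using c assms(2,3) by (simp_all add: dot_square_norm)
  have "(g ?y - g x) \<bullet> (g ?y - g x) = 2 * (g x \<bullet> g x - g ?y \<bullet> g x)"
    using gg by (simp add: inner_diff_left inner_diff_right inner_commute)
  also have "\<dots> \<le> 0" using grad_forward[OF assms(2-4)] by simp
  finally show eq: "g ?y = g x" by (metis inner_gt_zero_iff linorder_not_less eq_iff_diff_eq_0)
  show "v ?y = v x + t * c\<^sup>2"
    using support[OF assms(2), of ?y] support[OF assms(3), of x] gg(1)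
    by (simp add: eq inner_minus_right)
qed

lemma hess_grad_eq_0:
  assumes c: "\<And>x. x \<in> S \<Longrightarrow> norm (g x) = c" and "x \<in> S"
  shows "H x (g x) = 0" and "H x w \<bullet> g x = 0"
proof -
  have zero: "H x w \<bullet> g x = 0" for w
  proof -
    have "((\<lambda>y. g y \<bullet> g y) has_derivative (\<lambda>w. 2 * (H x w \<bullet> g x))) (at x)"
      by (auto intro!: derivative_eq_intros hess assms simp: inner_commute)
    moreover have "((\<lambda>y. g y \<bullet> g y) has_derivative (\<lambda>w. 0)) (at x)"
      by (rule has_derivative_transform_within_open[OF has_derivative_const[of "c\<^sup>2"] open_dom \<open>x \<in> S\<close>])
        (simp add: c dot_square_norm)
    ultimately have "(\<lambda>w. 2 * (H x w \<bullet> g x)) = (\<lambda>w. 0)" by (rule has_derivative_unique)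
    then show ?thesis by (metis mult_eq_0_iff zero_neq_numeral)
  qed
  then show "H x w \<bullet> g x = 0" .
  have "H x (g x) \<bullet> w' = 0" for w'
    using hess_sym[OF \<open>x \<in> S\<close>, of "g x" w'] zero by simp
  then show "H x (g x) = 0" by (metis inner_eq_zero_iff)
qed

lemma tr_hess:
  assumes c: "\<And>x. x \<in> S \<Longrightarrow> norm (g x) = c" "0 < c" and "x \<in> S"
  shows "tr (H x) = (real DIM('a) - 1) * c\<^sup>2 / v x"
proof -
  have "c\<^sup>2 * (v x * tr (H x)) = c\<^sup>2 * ((real DIM('a) - 1) * c\<^sup>2)"
    using equation[OF \<open>x \<in> S\<close>] hess_grad_eq_0(1)[OF c(1) \<open>x \<in> S\<close>] c(1)[OF \<open>x \<in> S\<close>]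
    by (simp add: p_trace_def dot_square_norm power2_eq_square mult_ac)
  then have "v x * tr (H x) = (real DIM('a) - 1) * c\<^sup>2" using \<open>0 < c\<close> by simp
  then show ?thesis using v_pos[OF \<open>x \<in> S\<close>] by (simp add: field_simps)
qed

text \<open>Differentiating \<open>g(z + t g z) = g z\<close> in \<open>z\<close> gives \<open>H\<^sub>t (1 + t H) = H\<close> for the Hessian \<open>H\<^sub>t\<close> at the displaced point.
  So \<open>t tr(H\<^sub>t H)\<close> is the difference of two traces that the equation determines. This replaces Bochner's formula, which
  would require third derivatives.\<close>
lemma tr_hess_square:
  assumes c: "\<And>x. x \<in> S \<Longrightarrow> norm (g x) = c" "0 < c" and "x \<in> S"
  shows "tr (\<lambda>w. H x (H x w)) = (real DIM('a) - 1) * (c\<^sup>2 / v x)\<^sup>2"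
proof -
  define y where "y t = x + t *\<^sub>R g x" for t
  have "(y \<longlongrightarrow> y 0) (at_right 0)" unfolding y_def by (intro tendsto_intros)
  then have y_lim: "(y \<longlongrightarrow> x) (at_right 0)" by (simp add: y_def)
  have ev: "\<forall>\<^sub>F t in at_right 0. y t \<in> S"
    using topological_tendstoD[OF y_lim open_dom \<open>x \<in> S\<close>] .
  have step: "tr (\<lambda>w. H (y t) (H x w)) = (real DIM('a) - 1) * c ^ 4 / (v x * (v x + t * c\<^sup>2))"
    if "0 < t" "y t \<in> S" for t
  proof -
    have rel: "H (y t) (w + t *\<^sub>R H x w) = H x w" for w
    proof -
      have inner: "((\<lambda>z. z + t *\<^sub>R g z) has_derivative (\<lambda>w. w + t *\<^sub>R H x w)) (at x)"
        by (auto intro!: derivative_eq_intros hess \<open>x \<in> S\<close>)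
      have yt: "x + t *\<^sub>R g x \<in> S" using that(2) by (simp add: y_def)
      from has_derivative_compose[OF inner hess[OF yt]]
      have "((\<lambda>z. g (z + t *\<^sub>R g z)) has_derivative (\<lambda>w. H (y t) (w + t *\<^sub>R H x w))) (at x)"
        by (simp add: y_def)
      moreover have "((\<lambda>z. g (z + t *\<^sub>R g z)) has_derivative H x) (at x)"
      proof (rule has_derivative_transform_eventually[OF hess[OF \<open>x \<in> S\<close>]])
        have "isCont (\<lambda>z. z + t *\<^sub>R g z) x" by (intro continuous_intros isCont_grad \<open>x \<in> S\<close>)
        then have "\<forall>\<^sub>F z in at x. z + t *\<^sub>R g z \<in> S"
          unfolding isCont_def by (rule topological_tendstoD[OF _ open_dom yt])
        moreover have "\<forall>\<^sub>F z in at x. z \<in> S"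
          using open_dom \<open>x \<in> S\<close> by (rule eventually_at_in_open')
        ultimately show "\<forall>\<^sub>F z in at x. g z = g (z + t *\<^sub>R g z)"
          by eventually_elim (use grad_constant_along_ray(1)[OF c(1)] \<open>0 < t\<close> in auto)
        show "g x = g (x + t *\<^sub>R g x)"
          using grad_constant_along_ray(1)[OF c(1) \<open>x \<in> S\<close> yt \<open>0 < t\<close>] by simp
      qed simp
      ultimately have "(\<lambda>w. H (y t) (w + t *\<^sub>R H x w)) = H x" by (rule has_derivative_unique)
      then show ?thesis by metis
    qed
    then have "H x w = H (y t) w + t *\<^sub>R H (y t) (H x w)" for w
      by (simp add: blinfun.add_right blinfun.scaleR_right)
    then have "tr (H x) = tr (\<lambda>w. H (y t) w + t *\<^sub>R H (y t) (H x w))" by simp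
    then have "t * tr (\<lambda>w. H (y t) (H x w)) = tr (H x) - tr (H (y t))" by (simp add: tr_simps)
    also have "\<dots> = (real DIM('a) - 1) * c\<^sup>2 / v x - (real DIM('a) - 1) * c\<^sup>2 / (v x + t * c\<^sup>2)"
      using tr_hess[OF c \<open>x \<in> S\<close>] tr_hess[OF c that(2)]
        grad_constant_along_ray(2)[OF c(1) \<open>x \<in> S\<close> _ \<open>0 < t\<close>] that(2)
      by (simp add: y_def)
    also have "\<dots> = t * ((real DIM('a) - 1) * c ^ 4 / (v x * (v x + t * c\<^sup>2)))"
    proof -
      have "0 < v x" "0 < v x + t * c\<^sup>2"
        using v_pos[OF \<open>x \<in> S\<close>] \<open>0 < t\<close> by (simp_all add: add_pos_nonneg)
      then show ?thesis by (simp add: field_simps power2_eq_square power4_eq_xxxx)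
    qed
    finally show ?thesis using \<open>0 < t\<close> by (simp only: mult_cancel_left) simp
  qed
  have "((\<lambda>t. tr (\<lambda>w. H (y t) (H x w))) \<longlongrightarrow> tr (\<lambda>w. H x (H x w))) (at_right 0)"
    unfolding tr_def
    by (intro tendsto_intros isCont_tendsto_compose[OF isCont_hess[OF \<open>x \<in> S\<close>] y_lim])
  moreover have "((\<lambda>t. (real DIM('a) - 1) * c ^ 4 / (v x * (v x + t * c\<^sup>2))) \<longlongrightarrow>
      (real DIM('a) - 1) * c ^ 4 / (v x * (v x + 0 * c\<^sup>2))) (at_right 0)"
    using v_pos[OF \<open>x \<in> S\<close>] by (intro tendsto_intros) auto
  then have "((\<lambda>t. tr (\<lambda>w. H (y t) (H x w))) \<longlongrightarrow>
      (real DIM('a) - 1) * c ^ 4 / (v x * (v x + 0 * c\<^sup>2))) (at_right 0)"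
  proof (rule Lim_transform_eventually)
    have "\<forall>\<^sub>F t in at_right (0::real). 0 < t" by (simp add: eventually_at_filter)
    with ev show "\<forall>\<^sub>F t in at_right 0. (real DIM('a) - 1) * c ^ 4 / (v x * (v x + t * c\<^sup>2))
        = tr (\<lambda>w. H (y t) (H x w))"
      by eventually_elim (simp add: step)
  qed
  ultimately have "tr (\<lambda>w. H x (H x w)) = (real DIM('a) - 1) * c ^ 4 / (v x * (v x + 0 * c\<^sup>2))"
    by (intro tendsto_unique) auto
  then show ?thesis by (simp add: power2_eq_square power4_eq_xxxx)
qed

text \<open>With both traces known, the squared norm of \<open>H - (c\<^sup>2/v)(1 - e e\<^sup>T)\<close>, for \<open>e\<close> the direction of \<open>g\<close>, is zero.\<close>
lemma hess_eq:
  assumes c: "\<And>x. x \<in> S \<Longrightarrow> norm (g x) = c" "0 < c" and "x \<in> S"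
  shows "v x *\<^sub>R H x w + (w \<bullet> g x) *\<^sub>R g x = c\<^sup>2 *\<^sub>R w"
proof -
  define a where "a = c\<^sup>2 / v x"
  have V: "0 < v x" using v_pos \<open>x \<in> S\<close> .
  define J where "J w = H x w - a *\<^sub>R w + (1 / v x) *\<^sub>R (w \<bullet> g x) *\<^sub>R g x" for w
  have lin: "linear J"
    by (intro linearI) (simp_all add: J_def blinfun.add_right blinfun.scaleR_right inner_add_left algebra_simps)
  note Hg = hess_grad_eq_0[OF c(1) \<open>x \<in> S\<close>]
  have gg: "g x \<bullet> g x = a * v x" using c(1)[OF \<open>x \<in> S\<close>] V by (simp add: a_def dot_square_norm)
  have "J w \<bullet> J w = H x (H x w) \<bullet> w - 2 * a * (H x w \<bullet> w) + a\<^sup>2 * (w \<bullet> w)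
      - (a / v x) * ((w \<bullet> g x) * (g x \<bullet> w))" for w
  proof -
    have "H x (H x w) \<bullet> w = H x w \<bullet> H x w"
      using hess_sym[OF \<open>x \<in> S\<close>, of "H x w" w] by simp
    moreover have "(A - a *\<^sub>R w + s *\<^sub>R G) \<bullet> (A - a *\<^sub>R w + s *\<^sub>R G)
        = A \<bullet> A - 2 * a * (A \<bullet> w) + a\<^sup>2 * (w \<bullet> w) + 2 * s * (A \<bullet> G) - 2 * a * s * (w \<bullet> G) + s\<^sup>2 * (G \<bullet> G)"
      for A G :: 'a and s
      by (simp add: inner_add_left inner_add_right inner_diff_left inner_diff_right inner_commute
          power2_eq_square algebra_simps)
    from this[of "H x w" "(w \<bullet> g x) / v x" "g x"]
    have "J w \<bullet> J w = H x w \<bullet> H x w - 2 * a * (H x w \<bullet> w) + a\<^sup>2 * (w \<bullet> w)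
        - 2 * a * ((w \<bullet> g x) / v x) * (w \<bullet> g x) + ((w \<bullet> g x) / v x)\<^sup>2 * (a * v x)"
      by (simp add: J_def Hg gg)
    moreover have "((w \<bullet> g x) / v x)\<^sup>2 * (a * v x) = a * ((w \<bullet> g x) / v x) * (w \<bullet> g x)"
      using V by (simp add: power2_eq_square)
    ultimately show ?thesis by (simp add: inner_commute[of "g x" w])
  qed
  then have "(\<Sum>b\<in>Basis. J b \<bullet> J b) = (\<Sum>b\<in>Basis. H x (H x b) \<bullet> b - 2 * a * (H x b \<bullet> b) + a\<^sup>2 * (b \<bullet> b)
      - (a / v x) * ((b \<bullet> g x) * (g x \<bullet> b)))" by simp
  also have "\<dots> = tr (\<lambda>w. H x (H x w)) - 2 * a * tr (H x) + a\<^sup>2 * real DIM('a) - (a / v x) * (g x \<bullet> g x)"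
    by (subst (4) euclidean_inner)
      (simp add: tr_def sum.distrib sum_subtractf sum_distrib_left inner_commute)
  also have "\<dots> = 0"
  proof -
    have "tr (H x) = (real DIM('a) - 1) * a"
      using tr_hess[OF c \<open>x \<in> S\<close>] by (simp add: a_def)
    moreover have "tr (\<lambda>w. H x (H x w)) = (real DIM('a) - 1) * a\<^sup>2"
      using tr_hess_square[OF c \<open>x \<in> S\<close>] by (simp add: a_def)
    moreover have "a / v x * (a * v x) = a\<^sup>2" using V by (simp add: power2_eq_square)
    ultimately show ?thesis by (simp only: gg) (simp add: power2_eq_square algebra_simps)
  qed
  finally have "\<forall>b\<in>Basis. J b \<bullet> J b = 0"
    by (subst (asm) sum_nonneg_eq_0_iff) auto
  then have "J w = 0"
    by (subst linear_eq_sum_Basis[OF lin]) simp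
  then have "v x *\<^sub>R (H x w + (1 / v x) *\<^sub>R (w \<bullet> g x) *\<^sub>R g x) = v x *\<^sub>R a *\<^sub>R w"
    by (simp add: J_def algebra_simps)
  then show ?thesis using V by (simp add: a_def scaleR_add_right)
qed

text \<open>By \<open>hess_eq\<close> the field \<open>v g - c\<^sup>2 x\<close>, half the gradient of \<open>v\<^sup>2 - c\<^sup>2|x|\<^sup>2\<close>, is constant; comparing lengths
  in \<open>v g = c\<^sup>2(x - x\<^sub>0)\<close> gives \<open>v\<close>.\<close>
theorem solution_is_cone:
  obtains c x\<^sub>0 where "0 < c" "\<And>x. x \<in> S \<Longrightarrow> v x = c * dist x x\<^sub>0"
proof -
  obtain c where c: "\<And>x. x \<in> S \<Longrightarrow> norm (g x) = c" "0 < c"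
    using norm_grad_constant by blast
  define X where "X x = v x *\<^sub>R g x - c\<^sup>2 *\<^sub>R x" for x
  have "(X has_derivative (\<lambda>h. 0)) (at x)" if "x \<in> S" for x
  proof -
    have "(X has_derivative (\<lambda>h. v x *\<^sub>R H x h + (h \<bullet> g x) *\<^sub>R g x - c\<^sup>2 *\<^sub>R h)) (at x)"
      unfolding X_def by (intro has_derivative_diff has_derivative_scaleR has_derivative_grad hess that
          has_derivative_scaleR_right has_derivative_ident)
    then show ?thesis by (simp add: hess_eq[OF c that])
  qed
  then have const: "X x = X y" if "x \<in> S" "y \<in> S" for x y
    using has_derivative_zero_unique_connected[OF open_dom connected_dom] that by blast
  obtain y where "y \<in> S" using norm_grad_attains_max by blast
  define x\<^sub>0 where "x\<^sub>0 = - (X y /\<^sub>R c\<^sup>2)"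
  have "v x = c * dist x x\<^sub>0" if "x \<in> S" for x
  proof -
    have "v x *\<^sub>R g x = c\<^sup>2 *\<^sub>R (x - x\<^sub>0)"
      using const[OF that \<open>y \<in> S\<close>] \<open>0 < c\<close> by (simp add: x\<^sub>0_def X_def[of x] algebra_simps)
    then have "norm (v x *\<^sub>R g x) = norm (c\<^sup>2 *\<^sub>R (x - x\<^sub>0))" by simp
    then have "c * v x = c * (c * dist x x\<^sub>0)"
      using c(1)[OF that] v_pos[OF that] by (simp add: dist_norm power2_eq_square mult_ac)
    then show ?thesis using \<open>0 < c\<close> by simp
  qed
  with \<open>0 < c\<close> show thesis by (rule that)
qed

end

section \<open>The capacitary potential\<close>

lemma gradient_eq:
  assumes "GDERIV f x :> D"
  shows "gradient f x = D"
  unfolding gradient_def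
proof (rule the_equality)
  show "GDERIV f x :> D" by (rule assms)
  fix D' assume "GDERIV f x :> D'"
  with assms have "(\<lambda>h. h \<bullet> D') = (\<lambda>h. h \<bullet> D)"
    unfolding gderiv_def by (intro has_derivative_unique)
  then show "D' = D" by (metis vector_eq_ldot)
qed

lemma divergence_eq:
  assumes "(V has_derivative D) (at x)"
  shows "divergence V x = tr D"
  unfolding divergence_def tr_def frechet_derivative_at[OF assms, symmetric] ..

lemma (in C2_function) p_harmonic_equation:
  assumes harm: "p_harmonic_on p S f" and "x \<in> S"
  shows "p_trace p (g x) (H x) = 0"
proof (cases "g x = 0")
  case False
  define N where "N = norm (g x)"
  have "0 < N" using False by (simp add: N_def)
  let ?D = "\<lambda>w. (N powr (p - 2)) *\<^sub>R H x w + (((p - 2) * N powr (p - 3)) * (H x w \<bullet> sgn (g x))) *\<^sub>R g x"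
  have "((\<lambda>s. s powr (p - 2)) has_real_derivative (p - 2) * N powr (p - 3)) (at N)"
    using has_real_derivative_powr[OF \<open>0 < N\<close>, of "p - 2"] by simp
  then have "((\<lambda>s. s powr (p - 2)) has_derivative (\<lambda>h. ((p - 2) * N powr (p - 3)) * h)) (at N)"
    by (simp add: has_field_derivative_def)
  moreover have "((\<lambda>y. norm (g y)) has_derivative (\<lambda>w. H x w \<bullet> sgn (g x))) (at x)"
    using has_derivative_compose[OF hess[OF \<open>x \<in> S\<close>] has_derivative_norm[OF False]] .
  ultimately have "((\<lambda>y. norm (g y) powr (p - 2)) has_derivative
      (\<lambda>w. ((p - 2) * N powr (p - 3)) * (H x w \<bullet> sgn (g x)))) (at x)"
    unfolding N_def by (rule has_derivative_compose[rotated])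
  from has_derivative_scaleR[OF this hess[OF \<open>x \<in> S\<close>]]
  have "((\<lambda>y. norm (g y) powr (p - 2) *\<^sub>R g y) has_derivative ?D) (at x)"
    by (simp add: N_def)
  then have "(p_flux p f has_derivative ?D) (at x)"
    by (rule has_derivative_transform_within_open[OF _ open_dom \<open>x \<in> S\<close>])
      (simp add: p_flux_def gradient_eq[OF grad])
  from divergence_eq[OF this]
  have "tr ?D = 0" using harm \<open>x \<in> S\<close> by (simp add: p_harmonic_on_def)
  also have "tr ?D = N powr (p - 2) * tr (H x) + ((p - 2) * N powr (p - 3)) * (H x (g x) \<bullet> sgn (g x))"
  proof -
    have "tr (\<lambda>w. (((p - 2) * N powr (p - 3)) * (H x w \<bullet> sgn (g x))) *\<^sub>R g x)
        = ((p - 2) * N powr (p - 3)) * (H x (\<Sum>b\<in>Basis. (g x \<bullet> b) *\<^sub>R b) \<bullet> sgn (g x))"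
      unfolding tr_def blinfun.sum_right inner_sum_left sum_distrib_left
      by (intro sum.cong) (simp_all add: blinfun.scaleR_right mult.assoc mult.left_commute)
    then show ?thesis by (simp add: tr_simps euclidean_representation)
  qed
  also have "\<dots> = N powr (p - 4) * p_trace p (g x) (H x)"
  proof -
    have "N powr (p - 2) = N powr (p - 4) * N\<^sup>2" "N powr (p - 3) = N powr (p - 4) * N"
      using \<open>0 < N\<close> by (simp_all add: powr_diff power2_eq_square)
        (simp_all add: powr_numeral eval_nat_numeral)
    moreover have "g x \<bullet> g x = N\<^sup>2" by (simp add: N_def dot_square_norm)
    ultimately show ?thesis
      using \<open>0 < N\<close> by (simp add: p_trace_def sgn_div_norm flip: N_def) (simp add: field_simps)
  qed
  finally show ?thesis using \<open>0 < N\<close> by simp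
qed (simp add: p_trace_def)

text \<open>With \<open>F1\<close> and \<open>F2\<close> the first two derivatives of \<open>s\<^sup>-\<^sup>k\<close> up to a constant factor, this says
  that \<open>|y|\<^sup>-\<^sup>2\<^sup>k\<close> is a strict subsolution of the \<open>p\<close>-Laplace equation when it decays faster than the fundamental
  solution \<open>|y|\<^sup>-\<^sup>q\<close>.\<close>
lemma p_trace_barrier:
  fixes y :: "'a::euclidean_space"
  assumes "0 < s" "y \<bullet> y = s" "0 < A" "0 < k" and k: "real DIM('a) - p < 2 * k * (p - 1)"
  defines "F1 \<equiv> - (k * A)" and "F2 \<equiv> k * (k + 1) * A / s"
  shows "0 < p_trace p (F1 *\<^sub>R 2 *\<^sub>R y) (\<lambda>w. (4 * F2) *\<^sub>R (w \<bullet> y) *\<^sub>R y + (2 * F1) *\<^sub>R w)"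
proof -
  have "p_trace p (F1 *\<^sub>R 2 *\<^sub>R y) (\<lambda>w. (4 * F2) *\<^sub>R (w \<bullet> y) *\<^sub>R y + (2 * F1) *\<^sub>R w)
      = 8 * (k * A) ^ 3 * s * (2 * k * (p - 1) - (real DIM('a) - p))"
    unfolding p_trace_rank_one_id using assms(1)
    by (simp add: assms(2) F1_def F2_def power2_eq_square power3_eq_cube field_simps)
  also have "0 < \<dots>" using assms by (intro mult_pos_pos) auto
  finally show ?thesis .
qed

text \<open>Comparison with a power of the distance to the centre of a ball inside \<open>\<Omega>\<close>. The exponent \<open>2k > q\<close> makes the
  barrier a strict subsolution, so that the first and second derivatives at an interior minimum of the difference already give a
  contradiction.\<close>
lemma potential_lower_bound:
  fixes \<Omega> :: "'a::euclidean_space set"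
  assumes C2: "C2_function (- closure \<Omega>) u g H"
    and eq: "\<And>x. x \<in> - closure \<Omega> \<Longrightarrow> p_trace p (g x) (H x) = 0"
    and cont: "continuous_on UNIV u" and pos: "\<And>x. 0 < u x" and one: "\<And>x. x \<in> closure \<Omega> \<Longrightarrow> u x = 1"
    and ball: "cball x\<^sub>0 \<rho> \<subseteq> closure \<Omega>" "0 < \<rho>" and "1 < p" "0 < k"
    and k: "real DIM('a) - p < 2 * k * (p - 1)" and y: "\<rho> \<le> dist y x\<^sub>0"
  shows "((y - x\<^sub>0) \<bullet> (y - x\<^sub>0) / \<rho>\<^sup>2) powr (- k) \<le> u y"
proof (rule ccontr)
  interpret C2_function "- closure \<Omega>" u g H by (rule C2)
  define b where "b x = ((x - x\<^sub>0) \<bullet> (x - x\<^sub>0) / \<rho>\<^sup>2) powr (- k)" for x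
  assume "\<not> ?thesis"
  then have neg: "u y < b y" by (simp add: b_def)
  have sq: "(x - x\<^sub>0) \<bullet> (x - x\<^sub>0) = (dist x x\<^sub>0)\<^sup>2" for x by (simp add: dist_norm power2_norm_eq_inner)
  have "\<forall>\<^sub>F s in at_top. s powr (- k) < b y - u y"
    using tendsto_neg_powr[of "- k" "\<lambda>s::real. s" at_top] \<open>0 < k\<close> neg
    by (intro order_tendstoD) (auto simp: filterlim_ident)
  then obtain T where T: "\<And>s. T \<le> s \<Longrightarrow> s powr (- k) < b y - u y"
    by (auto simp: eventually_at_top_linorder)
  define R where "R = \<rho> * max 1 T + dist y x\<^sub>0"
  have far: "b x - u x < b y - u y" if "R < dist x x\<^sub>0" for x
  proof -
    have "\<rho> * max 1 T \<le> dist x x\<^sub>0" using that zero_le_dist[of y x\<^sub>0] unfolding R_def by linarith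
    then have ratio: "max 1 T \<le> dist x x\<^sub>0 / \<rho>" using ball(2) by (simp add: pos_le_divide_eq mult.commute del: max.bounded_iff)
    have "T \<le> dist x x\<^sub>0 / \<rho> * 1" using ratio by simp
    also have "\<dots> \<le> dist x x\<^sub>0 / \<rho> * (dist x x\<^sub>0 / \<rho>)"
      using ratio by (intro mult_left_mono) auto
    finally have "T \<le> (x - x\<^sub>0) \<bullet> (x - x\<^sub>0) / \<rho>\<^sup>2" by (simp add: sq power2_eq_square)
    from T[OF this] show ?thesis using pos[of x] by (simp add: b_def)
  qed
  let ?K = "cball x\<^sub>0 R - ball x\<^sub>0 \<rho>"
  have "0 < R"
    using ball(2) y by (auto simp: R_def intro!: add_pos_nonneg mult_pos_pos)
  have "dist y x\<^sub>0 \<le> R" using ball(2) by (simp add: R_def)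
  have "\<exists>x\<in>?K. \<forall>x'\<in>?K. b x' - u x' \<le> b x - u x"
  proof (rule continuous_attains_sup)
    show "compact ?K" by (intro compact_diff compact_cball open_ball)
    show "?K \<noteq> {}" using y \<open>dist y x\<^sub>0 \<le> R\<close> by (auto simp: dist_commute intro!: exI[of _ y])
    have "continuous_on ?K u" using cont continuous_on_subset by blast
    moreover have "\<forall>x\<in>?K. (x - x\<^sub>0) \<bullet> (x - x\<^sub>0) / \<rho>\<^sup>2 \<noteq> 0"
      using ball(2) by auto
    ultimately show "continuous_on ?K (\<lambda>x. b x - u x)"
      unfolding b_def by (intro continuous_intros) auto
  qed
  then obtain x where x: "x \<in> ?K" "\<And>x'. x' \<in> ?K \<Longrightarrow> b x' - u x' \<le> b x - u x" by blast
  have Dx: "b y - u y \<le> b x - u x"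
    using x(2)[of y] y \<open>dist y x\<^sub>0 \<le> R\<close> by (simp add: dist_commute)
  have "x \<in> - closure \<Omega>"
  proof
    assume "x \<in> closure \<Omega>"
    have "1 \<le> (x - x\<^sub>0) \<bullet> (x - x\<^sub>0) / \<rho>\<^sup>2"
      using x(1) ball(2) power_mono[of \<rho> "dist x x\<^sub>0" 2] by (simp add: sq dist_commute)
    then have "b x \<le> 1 powr (- k)"
      unfolding b_def using \<open>0 < k\<close> by (intro powr_mono2') auto
    then show False using Dx neg one[OF \<open>x \<in> closure \<Omega>\<close>] by simp
  qed
  have outside: "\<rho> < dist x' x\<^sub>0" if "x' \<in> - closure \<Omega>" for x'
    using that ball(1) by (metis ComplD dist_commute mem_cball not_le_imp_less subsetD)
  have max: "\<forall>\<^sub>F x' in nhds x. b x' - u x' \<le> b x - u x"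
    using eventually_nhds_in_open[OF open_dom \<open>x \<in> - closure \<Omega>\<close>]
  proof eventually_elim
    case (elim x')
    show ?case
    proof (cases "dist x' x\<^sub>0 \<le> R")
      case True
      then show ?thesis using outside[OF elim] by (intro x(2)) (simp add: dist_commute)
    qed (use far[of x'] Dx in simp)
  qed
  define s where "s = (x - x\<^sub>0) \<bullet> (x - x\<^sub>0)"
  have "0 < s" using outside[OF \<open>x \<in> - closure \<Omega>\<close>] ball(2) by (auto simp: s_def sq)
  define F1 where "F1 s = - k / \<rho>\<^sup>2 * (s / \<rho>\<^sup>2) powr (- k - 1)" for s
  define A where "A = (s / \<rho>\<^sup>2) powr (- k - 1) / \<rho>\<^sup>2"
  define F2 where "F2 = k * (k + 1) * A / s"
  have "0 < A" using \<open>0 < s\<close> ball(2) by (simp add: A_def)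
  have F1: "F1 s = - (k * A)" by (simp add: F1_def A_def)
  have F1_der: "((\<lambda>s. (s / \<rho>\<^sup>2) powr (- k)) has_real_derivative F1 s) (at s)" if "0 < s" for s
  proof -
    have "((\<lambda>s. s / \<rho>\<^sup>2) has_real_derivative 1 / \<rho>\<^sup>2) (at s)"
      using DERIV_cdivide[OF DERIV_ident] .
    from DERIV_chain2[OF has_real_derivative_powr this, of "- k"] show ?thesis
      using that ball(2) by (simp add: F1_def)
  qed
  have F2_der: "(F1 has_real_derivative F2) (at s)"
  proof -
    have "((\<lambda>s. s / \<rho>\<^sup>2) has_real_derivative 1 / \<rho>\<^sup>2) (at s)"
      using DERIV_cdivide[OF DERIV_ident] .
    from DERIV_cmult[OF DERIV_chain2[OF has_real_derivative_powr this, of "- k - 1"], of "- k / \<rho>\<^sup>2"]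
    have "(F1 has_real_derivative (- k / \<rho>\<^sup>2) * ((- k - 1) * (s / \<rho>\<^sup>2) powr (- k - 1 - 1) * (1 / \<rho>\<^sup>2))) (at s)"
      using \<open>0 < s\<close> ball(2) unfolding F1_def[abs_def] by simp
    moreover
    have powr_pred: "(s / \<rho>\<^sup>2) powr (- k - 1 - 1) = (s / \<rho>\<^sup>2) powr (- k - 1) / (s / \<rho>\<^sup>2)"
      using \<open>0 < s\<close> ball(2) powr_diff[of "s / \<rho>\<^sup>2" "- k - 1" 1] by simp
    have "(- k / \<rho>\<^sup>2) * ((- k - 1) * (s / \<rho>\<^sup>2) powr (- k - 1 - 1) * (1 / \<rho>\<^sup>2)) = F2"
      unfolding powr_pred F2_def A_def using \<open>0 < s\<close> ball(2) by (simp add: field_simps)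
    ultimately show ?thesis by simp
  qed
  have sq_grad: "GDERIV (\<lambda>x. (x - x\<^sub>0) \<bullet> (x - x\<^sub>0)) x' :> 2 *\<^sub>R (x' - x\<^sub>0)" for x'
    unfolding gderiv_def by (auto intro!: derivative_eq_intros simp: inner_commute algebra_simps)
  have sq_hess: "((\<lambda>x. 2 *\<^sub>R (x - x\<^sub>0)) has_derivative (\<lambda>w. 2 *\<^sub>R w)) (at x')" for x'
    by (auto intro!: derivative_eq_intros)
  define G where "G x = F1 ((x - x\<^sub>0) \<bullet> (x - x\<^sub>0)) *\<^sub>R 2 *\<^sub>R (x - x\<^sub>0)" for x
  define K where "K w = (4 * F2) *\<^sub>R (w \<bullet> (x - x\<^sub>0)) *\<^sub>R (x - x\<^sub>0) + (2 * F1 s) *\<^sub>R w" for w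
  have b_grad: "GDERIV b x' :> G x'" if "x' \<in> - closure \<Omega>" for x'
  proof -
    have "0 < (x' - x\<^sub>0) \<bullet> (x' - x\<^sub>0)"
      using outside[OF that] ball(2) by (auto simp: sq)
    from GDERIV_DERIV_compose[OF sq_grad F1_der[OF this]]
    show ?thesis by (simp add: b_def[abs_def] G_def)
  qed
  have b_hess: "(G has_derivative K) (at x)"
    using hessian_compose[OF sq_grad sq_hess F2_der[unfolded s_def], folded s_def]
    unfolding G_def[abs_def] by (rule has_derivative_eq_rhs) (simp add: K_def fun_eq_iff s_def mult_ac)
  have diff_grad: "GDERIV (\<lambda>x. b x - u x) x' :> G x' - g x'" if "x' \<in> - closure \<Omega>" for x'
    by (intro GDERIV_diff b_grad grad that)
  have diff_hess: "((\<lambda>x. G x - g x) has_derivative (\<lambda>w. K w - H x w)) (at x)"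
    by (intro has_derivative_diff b_hess hess \<open>x \<in> - closure \<Omega>\<close>)
  note second = local_max_second_order[OF open_dom \<open>x \<in> - closure \<Omega>\<close> diff_grad diff_hess max]
  have gx: "g x = F1 s *\<^sub>R 2 *\<^sub>R (x - x\<^sub>0)"
    using second(1) by (simp add: G_def s_def)
  have "K w \<bullet> w \<le> H x w \<bullet> w" for w
    using second(2)[of w] by (simp add: inner_diff_left)
  then have "p_trace p (g x) K \<le> p_trace p (g x) (H x)"
    by (intro p_trace_mono \<open>1 < p\<close> linearI)
      (simp_all add: K_def blinfun.add_right blinfun.scaleR_right inner_add_left algebra_simps)
  moreover have "0 < p_trace p (g x) K"
    unfolding gx K_def[abs_def] F1 F2_def
    by (intro p_trace_barrier \<open>0 < s\<close> \<open>0 < A\<close> \<open>0 < k\<close> k) (simp add: s_def)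
  ultimately show False using eq[OF \<open>x \<in> - closure \<Omega>\<close>] by simp
qed

text \<open>A point of the closure farthest from \<open>x\<^sub>0\<close> lies on the frontier, so \<open>\<Omega>\<close> is inside the ball; the ball is connected
  and does not meet the frontier, so \<open>\<Omega>\<close> fills it.\<close>
lemma open_eq_ball_of_frontier:
  fixes \<Omega> :: "'a::euclidean_space set"
  assumes "open \<Omega>" "bounded \<Omega>" "\<Omega> \<noteq> {}" "0 < R" and frontier: "frontier \<Omega> \<subseteq> sphere x\<^sub>0 R"
  shows "\<Omega> = ball x\<^sub>0 R"
proof -
  have "\<exists>m\<in>closure \<Omega>. \<forall>x\<in>closure \<Omega>. dist x\<^sub>0 x \<le> dist x\<^sub>0 m"
    using assms(2,3) by (intro continuous_attains_sup continuous_intros) (auto simp: compact_closure)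
  then obtain m where m: "m \<in> closure \<Omega>" "\<And>x. x \<in> closure \<Omega> \<Longrightarrow> dist x\<^sub>0 x \<le> dist x\<^sub>0 m" by blast
  have "\<Omega> \<subseteq> cball x\<^sub>0 (dist x\<^sub>0 m)" using m(2) closure_subset by fastforce
  then have sub: "\<Omega> \<subseteq> ball x\<^sub>0 (dist x\<^sub>0 m)"
    using interior_maximal[OF _ assms(1)] by (metis interior_cball)
  then have "m \<notin> \<Omega>" by auto
  then have "m \<in> frontier \<Omega>" using m(1) assms(1) by (simp add: frontier_def interior_open)
  then have "dist x\<^sub>0 m = R" using frontier by auto
  with sub have sub: "\<Omega> \<subseteq> ball x\<^sub>0 R" by simp
  have "ball x\<^sub>0 R \<inter> frontier \<Omega> = {}" using frontier by auto
  moreover have "ball x\<^sub>0 R \<inter> \<Omega> \<noteq> {}" using sub assms(3) by auto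
  ultimately have "ball x\<^sub>0 R - \<Omega> = {}"
    using connected_Int_frontier[OF connected_ball] by blast
  with sub show ?thesis by auto
qed

text \<open>For \<open>r = -1/q\<close> the condition on \<open>r\<close> holds, and \<open>u\<^sup>r\<close> is the transform that takes the fundamental solution to a cone.\<close>
lemma cone_equation_power:
  fixes S :: "'a::euclidean_space set"
  assumes C2: "C2_function S u g H" and eq: "\<And>x. x \<in> S \<Longrightarrow> p_trace p (g x) (H x) = 0"
    and pos: "\<And>x. 0 < u x" and "1 < p" and r: "(r - 1) * (p - 1) = (real DIM('a) - 1) * r"
  obtains K where "cone_equation S (\<lambda>x. u x powr r) (\<lambda>x. (r * u x powr (r - 1)) *\<^sub>R g x) K p"
proof -
  interpret C2_function S u g H by (rule C2)
  define K where "K x = (r * (r - 1) * u x powr (r - 2)) *\<^sub>R (blinfun_scaleR_left (g x) o\<^sub>L blinfun_inner_left (g x))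
      + (r * u x powr (r - 1)) *\<^sub>R H x" for x
  have K: "blinfun_apply (K x) = (\<lambda>w. ((r * (r - 1) * u x powr (r - 2)) * (w \<bullet> g x)) *\<^sub>R g x
      + (r * u x powr (r - 1)) *\<^sub>R H x w)" for x
    by (simp add: K_def fun_eq_iff blinfun.add_left blinfun.scaleR_left)
  have "cone_equation S (\<lambda>x. u x powr r) (\<lambda>x. (r * u x powr (r - 1)) *\<^sub>R g x) K p"
  proof
    show "open S" by (rule open_dom)
    show "GDERIV (\<lambda>x. u x powr r) x :> (r * u x powr (r - 1)) *\<^sub>R g x" if "x \<in> S" for x
      by (rule GDERIV_DERIV_compose[OF grad[OF that] has_real_derivative_powr[OF pos]])
    show "((\<lambda>x. (r * u x powr (r - 1)) *\<^sub>R g x) has_derivative blinfun_apply (K x)) (at x)" if "x \<in> S" for x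
    proof -
      have "((\<lambda>s. r * s powr (r - 1)) has_real_derivative r * (r - 1) * u x powr (r - 2)) (at (u x))"
        using DERIV_cmult[OF has_real_derivative_powr[OF pos, of "r - 1" x], of r] by (simp add: mult.assoc)
      from hessian_compose[OF grad[OF that] hess[OF that] this] show ?thesis by (simp add: K)
    qed
    have cont_g: "continuous_on S g" using isCont_grad by (simp add: continuous_at_imp_continuous_on)
    have cont_u: "continuous_on S u"
      using has_derivative_continuous[OF has_derivative_grad] by (simp add: continuous_at_imp_continuous_on)
    have "\<forall>x\<in>S. u x \<noteq> 0" using pos by (metis less_irrefl)
    then show "continuous_on S K"
      unfolding K_def using hess_cont cont_u cont_g
      by (intro continuous_intros bounded_linear.continuous_on[OF bounded_linear_blinfun_scaleR_left]
          bounded_linear.continuous_on[OF bounded_linear_blinfun_inner_left]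
          bounded_bilinear.continuous_on[OF bounded_bilinear_blinfun_compose]) auto
    show "1 < p" by fact
    show "0 < u x powr r" if "x \<in> S" for x using pos[of x] by simp
    show "u x powr r * p_trace p ((r * u x powr (r - 1)) *\<^sub>R g x) (blinfun_apply (K x))
        = (real DIM('a) - 1) * ((r * u x powr (r - 1)) *\<^sub>R g x \<bullet> (r * u x powr (r - 1)) *\<^sub>R g x)\<^sup>2" if "x \<in> S" for x
    proof -
      define V where "V = u x powr r"
      define U where "U = u x"
      have "0 < U" using pos by (simp add: U_def)
      have p1: "u x powr (r - 1) = V / U" using pos[of x] by (simp add: V_def U_def powr_diff)
      have p2: "u x powr (r - 2) = V / U\<^sup>2" using pos[of x] by (simp add: V_def U_def powr_diff)
      have "p_trace p ((r * u x powr (r - 1)) *\<^sub>R g x) (blinfun_apply (K x))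
          = (r * V / U)\<^sup>2 * (r * (r - 1) * (V / U\<^sup>2) * (p - 1) * (g x \<bullet> g x)\<^sup>2)"
      proof -
        have "p_trace p (g x) (blinfun_apply (K x)) = r * (r - 1) * (V / U\<^sup>2) * (p - 1) * (g x \<bullet> g x)\<^sup>2"
          unfolding K p_trace_compose by (simp add: eq[OF that] p2)
        then show ?thesis
          unfolding p1
          by (subst p_trace_scale_vector[OF bounded_linear.linear[OF blinfun.bounded_linear_right]]) simp
      qed
      then have "V * p_trace p ((r * u x powr (r - 1)) *\<^sub>R g x) (blinfun_apply (K x))
          = (V / U) ^ 4 * (g x \<bullet> g x)\<^sup>2 * r ^ 3 * ((r - 1) * (p - 1))"
        by (simp add: power2_eq_square power3_eq_cube power4_eq_xxxx mult_ac)
      also have "\<dots> = (real DIM('a) - 1) * ((r * (V / U)) *\<^sub>R g x \<bullet> (r * (V / U)) *\<^sub>R g x)\<^sup>2"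
        unfolding r by (simp add: power2_eq_square power3_eq_cube power4_eq_xxxx mult_ac)
      finally show ?thesis by (simp add: V_def[symmetric] p1)
    qed
  qed
  then show thesis by (rule that)
qed

text \<open>What remains is to place \<open>v = u\<^sup>-\<^sup>1\<^sup>/\<^sup>q\<close> in the locale above. The bound on its gradient combines convexity with the lower bound
  for \<open>u\<close>, which makes \<open>v\<close> grow at most linearly. Once \<open>v\<close> is a cone outside \<open>\<Omega>\<close>, its value \<open>1\<close> on the frontier puts the
  frontier on a sphere.\<close>
theorem capacitary_potential_ball:
  fixes \<Omega> :: "'a::euclidean_space set" and u :: "'a \<Rightarrow> real"
  assumes dim: "2 \<le> DIM('a)" and p: "1 < p" "p < real DIM('a)"
    and \<Omega>: "\<Omega> \<noteq> {}" "open \<Omega>" "bounded \<Omega>" "convex \<Omega>"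
    and pot: "p_capacitary_potential p \<Omega> u"
    and q_def: "q = (real DIM('a) - p) / (p - 1)"
    and conc: "alpha_concave (- 1 / q) u"
  shows "\<exists>x\<^sub>0 R. 0 < R \<and> \<Omega> = ball x\<^sub>0 R"
proof -
  let ?S = "- closure \<Omega>"
  have "0 < q" using p by (simp add: q_def)
  define r where "r = - 1 / q"
  have "r < 0" using \<open>0 < q\<close> by (simp add: r_def)
  define v where "v x = u x powr r" for x
  have cont: "continuous_on UNIV u" and harm: "p_harmonic_on p ?S u"
    and one: "\<And>x. x \<in> closure \<Omega> \<Longrightarrow> u x = 1" and lim: "(u \<longlongrightarrow> 0) at_infinity"
    using pot by (auto simp: p_capacitary_potential_def)
  have pos: "0 < u x" for x using conc by (simp add: alpha_concave_def)
  have convex_v: "convex_on UNIV v" using conc by (simp add: alpha_concave_def v_def[abs_def] r_def)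
  obtain g H where "C2_function ?S u g H"
    using harm unfolding p_harmonic_on_def C2_on_def C2_function_def by (auto simp: open_Compl)
  then interpret u: C2_function ?S u g H .
  have eq: "p_trace p (g x) (H x) = 0" if "x \<in> ?S" for x
    using u.p_harmonic_equation[OF harm that] .
  have "(r - 1) * (p - 1) = (real DIM('a) - 1) * r"
    using p by (simp add: r_def q_def field_simps)
  then obtain K where "cone_equation ?S (\<lambda>x. u x powr r) (\<lambda>x. (r * u x powr (r - 1)) *\<^sub>R g x) K p"
    using cone_equation_power[OF u.C2_function_axioms eq pos p(1)] by blast
  then have "cone_equation ?S v (\<lambda>x. (r * u x powr (r - 1)) *\<^sub>R g x) K p"
    by (simp add: v_def[abs_def])
  then obtain gv where "cone_equation ?S v gv K p" by blast
  then interpret v: cone_equation ?S v gv K p .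
  have v_lim: "filterlim v at_top at_infinity"
    unfolding filterlim_at_top
  proof
    fix Z
    define \<delta> where "\<delta> = (max Z 1) powr (1 / r)"
    have "0 < \<delta>" by (simp add: \<delta>_def)
    have "\<delta> powr r = max Z 1" using \<open>r < 0\<close> by (simp add: \<delta>_def powr_powr)
    have "\<forall>\<^sub>F x in at_infinity. u x < \<delta>" using lim \<open>0 < \<delta>\<close> by (rule order_tendstoD)
    then show "\<forall>\<^sub>F x in at_infinity. Z \<le> v x"
    proof eventually_elim
      case (elim x)
      have "\<delta> powr r < v x"
        unfolding v_def using \<open>r < 0\<close> pos elim by (rule powr_less_mono2_neg)
      then show ?case using \<open>\<delta> powr r = max Z 1\<close> by simp
    qed
  qed
  obtain x\<^sub>0 \<rho> where ball: "cball x\<^sub>0 \<rho> \<subseteq> \<Omega>" "0 < \<rho>"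
    using \<Omega>(1,2) open_contains_cball by (metis ex_in_conv)
  have v_le: "v x \<le> 1 + dist x x\<^sub>0 / \<rho>" for x
  proof (cases "\<rho> \<le> dist x x\<^sub>0")
    case True
    define T where "T = dist x x\<^sub>0 / \<rho>"
    have "0 < T" using True ball(2) unfolding T_def by (intro divide_pos_pos) linarith+
    have sq: "(x - x\<^sub>0) \<bullet> (x - x\<^sub>0) / \<rho>\<^sup>2 = T\<^sup>2"
      by (simp add: T_def power_divide dist_norm power2_norm_eq_inner)
    have "(T\<^sup>2) powr (- k) \<le> u x" if "q / 2 < k" for k
    proof -
      have "real DIM('a) - p = q * (p - 1)" using p by (simp add: q_def)
      also have "\<dots> < 2 * k * (p - 1)" using that p by simp
      finally have "real DIM('a) - p < 2 * k * (p - 1)" .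
      moreover have "cball x\<^sub>0 \<rho> \<subseteq> closure \<Omega>" using ball(1) closure_subset by blast
      ultimately show ?thesis
        unfolding sq[symmetric] using that \<open>0 < q\<close> True ball(2) p(1)
        by (intro potential_lower_bound[OF u.C2_function_axioms eq cont pos one]) auto
    qed
    moreover have "((\<lambda>k. (T\<^sup>2) powr (- k)) \<longlongrightarrow> (T\<^sup>2) powr (- (q / 2))) (at_right (q / 2))"
      using \<open>0 < T\<close> by (intro tendsto_intros) auto
    \<comment> \<open>The comparison is available for exponents \<open>2k > q\<close>; the sharp exponent \<open>q\<close> is reached in the limit.\<close>
    ultimately have "(T\<^sup>2) powr (- (q / 2)) \<le> u x"
      by (intro tendsto_upperbound[where F = "at_right (q / 2)"]) (auto simp: eventually_at_filter)
    also have "(T\<^sup>2) powr (- (q / 2)) = T powr (- q)"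
      using \<open>0 < T\<close> powr_powr[of T 2 "- (q / 2)"] by (simp add: powr_numeral)
    finally have "v x \<le> (T powr (- q)) powr r"
      unfolding v_def using \<open>r < 0\<close> \<open>0 < T\<close> by (intro powr_mono2') auto
    also have "\<dots> = T" using \<open>0 < T\<close> \<open>0 < q\<close> by (simp add: powr_powr r_def)
    finally show ?thesis by (simp add: T_def)
  next
    case False
    then have "x \<in> closure \<Omega>" using ball(1) closure_subset[of \<Omega>] by (auto simp: dist_commute subset_iff)
    then show ?thesis using one ball(2) by (simp add: v_def)
  qed
  have grad_le: "norm (gv x) \<le> 1 / \<rho>" if "x \<in> ?S" for x
  proof (rule ccontr)
    define P where "P = norm (gv x)"
    assume "\<not> ?thesis"
    then have P: "1 / \<rho> < P" by (simp add: P_def)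
    then have "0 < P" using ball(2) by (meson less_trans zero_less_divide_1_iff)
    define M where "M = 1 + dist x x\<^sub>0 / \<rho>"
    have "0 < M" using ball(2) by (simp add: M_def add_pos_nonneg)
    \<comment> \<open>The time after which growth of slope \<open>P > 1/\<rho>\<close> overtakes the linear bound.\<close>
    define t where "t = M / (P * (P - 1 / \<rho>))"
    have "0 < t" using P \<open>0 < P\<close> \<open>0 < M\<close> by (simp add: t_def)
    have "v x + t * P\<^sup>2 \<le> v (x + t *\<^sub>R gv x)"
      using convex_above_tangent[OF convex_v v.grad[OF that], of "x + t *\<^sub>R gv x"]
      by (simp add: P_def dot_square_norm)
    also have "\<dots> \<le> 1 + dist (x + t *\<^sub>R gv x) x\<^sub>0 / \<rho>" by (rule v_le)
    also have "\<dots> \<le> 1 + (dist x x\<^sub>0 + t * P) / \<rho>"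
    proof -
      have "dist (x + t *\<^sub>R gv x) x\<^sub>0 \<le> dist x x\<^sub>0 + t * P"
        using norm_triangle_ineq[of "x - x\<^sub>0" "t *\<^sub>R gv x"] \<open>0 < t\<close>
        by (simp add: dist_norm P_def algebra_simps)
      then show ?thesis using ball(2) by (simp add: divide_right_mono)
    qed
    finally have "v x + t * (P * (P - 1 / \<rho>)) \<le> M"
      by (simp add: M_def power2_eq_square add_divide_distrib algebra_simps)
    moreover have "t * (P * (P - 1 / \<rho>)) = M" using P \<open>0 < P\<close> by (simp add: t_def)
    ultimately show False using v.v_pos[OF that] by simp
  qed
  interpret v: convex_exterior_solution ?S v gv K p
  proof
    show "p < real DIM('a)" "convex_on UNIV v" "filterlim v at_top at_infinity"
      using p convex_v v_lim by auto
    show "bounded (- ?S)" using \<Omega>(3) by (simp add: bounded_closure)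
    show "connected ?S" using \<Omega>(3,4) dim
      by (intro connected_complement_bounded_convex bounded_closure convex_closure)
    show "bounded (gv ` ?S)" using grad_le by (auto simp: bounded_iff)
  qed
  obtain c x\<^sub>1 where c: "0 < c" "\<And>x. x \<in> ?S \<Longrightarrow> v x = c * dist x x\<^sub>1"
    using v.solution_is_cone by blast
  have "frontier \<Omega> \<subseteq> sphere x\<^sub>1 (1 / c)"
  proof
    fix x assume x: "x \<in> frontier \<Omega>"
    have cont_v: "continuous_on UNIV v"
      unfolding v_def[abs_def] using cont pos by (intro continuous_intros) (auto dest: less_imp_neq[THEN not_sym] simp: less_imp_neq)
    then have "closed {x. v x = c * dist x x\<^sub>1}"
      by (intro closed_Collect_eq continuous_intros) auto
    then have "closure ?S \<subseteq> {x. v x = c * dist x x\<^sub>1}"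
      using c(2) by (intro closure_minimal) auto
    moreover have "x \<in> closure ?S"
      using x \<Omega>(2,4) by (simp add: closure_complement convex_interior_closure frontier_def interior_open)
    ultimately have "v x = c * dist x x\<^sub>1" by auto
    moreover have "v x = 1" using x one by (simp add: v_def frontier_def)
    ultimately show "x \<in> sphere x\<^sub>1 (1 / c)" using c(1) by (simp add: dist_commute field_simps)
  qed
  with \<Omega> c(1) have "\<Omega> = ball x\<^sub>1 (1 / c)"
    by (intro open_eq_ball_of_frontier) auto
  then show ?thesis using c(1) by (intro exI[of _ x\<^sub>1] exI[of _ "1 / c"]) simp
qed

theorem theorem1p1:
  fixes \<Omega> :: "(real ^ 'n) set" and u :: "real ^ 'n \<Rightarrow> real" and p q :: real
  assumes "CARD('n) \<ge> 3"
    and "1 < p" and "p < real CARD('n)"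
    and "\<Omega> \<noteq> {}" and "open \<Omega>" and "bounded \<Omega>" and "convex \<Omega>"
    and "p_capacitary_potential p \<Omega> u"
    and "q = (real CARD('n) - p) / (p - 1)"
    and "alpha_concave (- 1 / q) u"
  shows "\<exists>x0 R. R > 0 \<and> \<Omega> = ball x0 R"
  using assms by (intro capacitary_potential_ball[of p \<Omega> u q]) simp_all

end
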